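(* For every $c_0>0$ and every $r>0$ there exists a constant $C=C(r,c_0)$ such that the following holds. Let $A$ be the adjacency matrix of a random graph on $n$ nodes in which edges occur independently. Set $\mathbb E[A]=P=(p_{ij})_{i,j=1,\ldots,n}$ and assume that $n\max_{i,j}p_{ij}\le d$ for some $d\ge c_0\log n$. Then $$\|A-P\|\le C\sqrt d$$ with probability at least $1-n^{-r}$.
   Context: The graph is simple and undirected, so $A$ is a symmetric $n\times n$ matrix with entries in $\{0,1\}$ and zero diagonal, and the entries $a_{ij}$, $i<j$, are independent Bernoulli random variables with $\mathbb E(a_{ij})=p_{ij}$. $\|\cdot\|$ is the spectral (operator) norm. *)

theory Defs
  imports "HOL-Probability.Probability" "Jordan_Normal_Form.Matrix"
begin

text \<open>
  Simple undirected graphs on the nodes \<open>0, \<dots>, n - 1\<close> are represented by their edge sets, an edge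
  being a two-element set of nodes. A random graph is a probability distribution on these graphs;
  as the sample space is finite, a \<open>pmf\<close> loses no generality.
\<close>

definition node_pairs :: "nat \<Rightarrow> nat set set" where
  "node_pairs n = {{i, j} |i j. i < j \<and> j < n}"

definition adjacency_matrix :: "nat \<Rightarrow> nat set set \<Rightarrow> real mat" where
  "adjacency_matrix n E = mat n n (\<lambda>(i, j). if i \<noteq> j \<and> {i, j} \<in> E then 1 else 0)"

definition random_graph :: "nat \<Rightarrow> nat set set pmf \<Rightarrow> bool" where
  "random_graph n G \<longleftrightarrow> set_pmf G \<subseteq> Pow (node_pairs n)"

definition independent_edges :: "nat \<Rightarrow> nat set set pmf \<Rightarrow> bool" where
  "independent_edges n G \<longleftrightarrow>
     prob_space.indep_vars (measure_pmf G) (\<lambda>_. borel)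
       (\<lambda>(i, j) E. adjacency_matrix n E $$ (i, j)) {(i, j). i < j \<and> j < n}"

definition expected_adjacency_matrix :: "nat \<Rightarrow> nat set set pmf \<Rightarrow> real mat" where
  "expected_adjacency_matrix n G =
     mat n n (\<lambda>ij. measure_pmf.expectation G (\<lambda>E. adjacency_matrix n E $$ ij))"

definition euclidean_norm :: "real vec \<Rightarrow> real" where
  "euclidean_norm x = L2_set (\<lambda>i. vec_index x i) {..<dim_vec x}"

text \<open>
  The operator norm with respect to Euclidean norms, as in the library's \<^const>\<open>onorm\<close>
  (which needs the dimension to be fixed by a type); the zero vector contributes \<open>0 / 0 = 0\<close>.
\<close>

definition spectral_norm :: "real mat \<Rightarrow> real" where
  "spectral_norm A =
     (SUP x\<in>carrier_vec (dim_col A). euclidean_norm (A *\<^sub>v x) / euclidean_norm x)"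

end

theory Submission
  imports Defs
begin

text \<open>
  Expand the trace of \<open>(A - P)\<^sup>L\<close>, \<open>L = 2p\<close>, over closed walks of length \<open>L\<close>. As the entries are
  centred, only walks that use each of their edges at least twice contribute; such a walk visits
  \<open>v \<le> p + 1\<close> nodes and contributes at most \<open>\<delta>\<close> to the power \<open>v - 1\<close>, where \<open>\<delta>\<close> is the largest edge
  probability. Group the walks by their equality pattern. A pattern with \<open>v\<close> nodes has at most \<open>n\<^sup>v\<close>
  walks in \<open>n\<close> nodes and at least \<open>L p\<^sup>v / p\<close> walks in \<open>L\<close> nodes, so that for \<open>n \<delta> \<le> d \<le> p\<close> the
  expected trace is at most \<open>n / L\<close> times that of an \<open>L \<times> L\<close> matrix \<open>Y\<close> with independent
  centred entries whose higher moments are all at least 1 (a comparison in the spirit of Bandeira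
  and van Handel). An integer lattice net and Hoeffding's lemma show that \<open>\<parallel>Y\<parallel>\<close> is of order \<open>\<surd>L\<close>, also
  in the \<open>L\<close>-th moment. The claim follows from Markov's inequality with \<open>p\<close> of order \<open>d\<close> and at
  least \<open>ln n\<close>.
\<close>

section \<open>Symmetric matrices as functions\<close>

text \<open>Matrices are functions with the size as a parameter because the proof compares matrices
  of size \<open>n\<close> with matrices of size \<open>2 * p\<close>. Values at indices from
  \<open>n\<close> on never enter.\<close>

definition mat_app :: "nat \<Rightarrow> (nat \<Rightarrow> nat \<Rightarrow> real) \<Rightarrow> (nat \<Rightarrow> real) \<Rightarrow> nat \<Rightarrow> real" where
  "mat_app n M x i = (\<Sum>j<n. M i j * x j)"

definition dot :: "nat \<Rightarrow> (nat \<Rightarrow> real) \<Rightarrow> (nat \<Rightarrow> real) \<Rightarrow> real" where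
  "dot n x y = (\<Sum>i<n. x i * y i)"

abbreviation nrm :: "nat \<Rightarrow> (nat \<Rightarrow> real) \<Rightarrow> real" where
  "nrm n x \<equiv> L2_set x {..<n}"

primrec mat_pow :: "nat \<Rightarrow> (nat \<Rightarrow> nat \<Rightarrow> real) \<Rightarrow> nat \<Rightarrow> nat \<Rightarrow> nat \<Rightarrow> real" where
  "mat_pow n M 0 = (\<lambda>i j. of_bool (i = j))"
| "mat_pow n M (Suc k) = (\<lambda>i j. \<Sum>l<n. mat_pow n M k i l * M l j)"

definition mat_trace :: "nat \<Rightarrow> (nat \<Rightarrow> nat \<Rightarrow> real) \<Rightarrow> real" where
  "mat_trace n M = (\<Sum>i<n. M i i)"

definition sym_mat :: "nat \<Rightarrow> (nat \<Rightarrow> nat \<Rightarrow> real) \<Rightarrow> bool" where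
  "sym_mat n M \<longleftrightarrow> (\<forall>i<n. \<forall>j<n. M i j = M j i)"

definition unit_fun :: "nat \<Rightarrow> nat \<Rightarrow> real" where
  "unit_fun j i = of_bool (i = j)"

lemma nrm_square: "(nrm n x)\<^sup>2 = dot n x x"
  unfolding L2_set_def dot_def by (simp add: sum_nonneg power2_eq_square)

lemma dot_le_nrm: "dot n x y \<le> nrm n x * nrm n y"
proof -
  have "dot n x y \<le> (\<Sum>i<n. \<bar>x i\<bar> * \<bar>y i\<bar>)"
    unfolding dot_def by (intro sum_mono) (metis abs_ge_self abs_mult)
  also have "\<dots> \<le> nrm n x * nrm n y" by (rule L2_set_mult_ineq)
  finally show ?thesis .
qed

text \<open>Links the two views of a power: its entries are sums over walks, while its action on
  vectors is what norms control.\<close>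

lemma funpow_mat_app:
  assumes "i < n"
  shows "(mat_app n M ^^ k) x i = (\<Sum>j<n. mat_pow n M k i j * x j)"
  using assms
proof (induction k arbitrary: x)
  case 0
  then show ?case by (simp add: of_bool_def if_distrib[of "\<lambda>a. a * _"] cong: if_cong)
next
  case (Suc k)
  have "(mat_app n M ^^ Suc k) x i = (mat_app n M ^^ k) (mat_app n M x) i"
    by (simp add: funpow_Suc_right del: funpow.simps)
  also have "\<dots> = (\<Sum>l<n. mat_pow n M k i l * mat_app n M x l)"
    using Suc by blast
  also have "\<dots> = (\<Sum>l<n. \<Sum>j<n. mat_pow n M k i l * M l j * x j)"
    by (simp add: mat_app_def sum_distrib_left mult.assoc)
  also have "\<dots> = (\<Sum>j<n. mat_pow n M (Suc k) i j * x j)"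
    by (subst sum.swap) (simp add: sum_distrib_right)
  finally show ?case .
qed

lemma mat_pow_eq_funpow_unit:
  assumes "i < n" "j < n"
  shows "mat_pow n M k i j = (mat_app n M ^^ k) (unit_fun j) i"
  using assms
  by (simp add: funpow_mat_app unit_fun_def of_bool_def if_distrib[of "\<lambda>a. _ * a"] cong: if_cong)

lemma dot_mat_app:
  assumes "sym_mat n M"
  shows "dot n (mat_app n M x) y = dot n x (mat_app n M y)"
proof -
  have "dot n (mat_app n M x) y = (\<Sum>i<n. \<Sum>j<n. M i j * x j * y i)"
    by (simp add: dot_def mat_app_def sum_distrib_right)
  also have "\<dots> = (\<Sum>j<n. \<Sum>i<n. M i j * x j * y i)"
    by (rule sum.swap)
  also have "\<dots> = (\<Sum>j<n. \<Sum>i<n. x j * (M j i * y i))"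
    using assms by (intro sum.cong refl) (simp add: sym_mat_def)
  also have "\<dots> = dot n x (mat_app n M y)"
    by (simp add: dot_def mat_app_def sum_distrib_left)
  finally show ?thesis .
qed

lemma dot_funpow_mat_app:
  assumes "sym_mat n M"
  shows "dot n ((mat_app n M ^^ k) x) y = dot n x ((mat_app n M ^^ k) y)"
proof (induction k arbitrary: y)
  case (Suc k)
  have "dot n ((mat_app n M ^^ Suc k) x) y = dot n ((mat_app n M ^^ k) x) (mat_app n M y)"
    by (simp add: dot_mat_app[OF assms])
  also have "\<dots> = dot n x ((mat_app n M ^^ k) (mat_app n M y))" by (rule Suc)
  finally show ?case by (simp add: funpow_swap1)
qed simp

text \<open>By symmetry one half of the power moves to the other side of the inner product, so each
  diagonal entry is a square. This yields positivity and both the upper and the lower estimates of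
  even traces.\<close>

lemma mat_trace_even_pow:
  assumes "sym_mat n M"
  shows "mat_trace n (mat_pow n M (2 * p)) = (\<Sum>j<n. (nrm n ((mat_app n M ^^ p) (unit_fun j)))\<^sup>2)"
  unfolding mat_trace_def
proof (intro sum.cong refl)
  fix j assume "j \<in> {..<n}"
  hence j: "j < n" by simp
  have "mat_pow n M (2 * p) j j = (mat_app n M ^^ (p + p)) (unit_fun j) j"
    using j by (simp add: mat_pow_eq_funpow_unit mult_2)
  also have "\<dots> = dot n (unit_fun j) ((mat_app n M ^^ p) ((mat_app n M ^^ p) (unit_fun j)))"
    using j by (simp add: funpow_add dot_def unit_fun_def of_bool_def
        if_distrib[of "\<lambda>a. a * _"] cong: if_cong)
  also have "\<dots> = (nrm n ((mat_app n M ^^ p) (unit_fun j)))\<^sup>2"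
    by (simp add: dot_funpow_mat_app[OF assms, symmetric] nrm_square)
  finally show "mat_pow n M (2 * p) j j = (nrm n ((mat_app n M ^^ p) (unit_fun j)))\<^sup>2" .
qed

lemma mat_trace_even_pow_nonneg:
  assumes "sym_mat n M"
  shows "0 \<le> mat_trace n (mat_pow n M (2 * p))"
  unfolding mat_trace_even_pow[OF assms] by (intro sum_nonneg) simp

lemma mat_trace_even_pow_le:
  assumes "sym_mat n M" and "\<And>x. nrm n (mat_app n M x) \<le> S * nrm n x" and "0 \<le> S"
  shows "mat_trace n (mat_pow n M (2 * p)) \<le> n * S ^ (2 * p)"
proof -
  have iter: "nrm n ((mat_app n M ^^ k) x) \<le> S ^ k * nrm n x" for k x
  proof (induction k)
    case (Suc k)
    have "nrm n ((mat_app n M ^^ Suc k) x) \<le> S * nrm n ((mat_app n M ^^ k) x)"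
      using assms(2) by simp
    also have "\<dots> \<le> S * (S ^ k * nrm n x)"
      using Suc assms(3) by (intro mult_left_mono)
    finally show ?case by (simp add: mult.assoc)
  qed simp
  have "(nrm n ((mat_app n M ^^ p) (unit_fun j)))\<^sup>2 \<le> S ^ (2 * p)" if "j < n" for j
  proof -
    have "nrm n (unit_fun j) = 1"
      using that by (simp add: L2_set_def unit_fun_def of_bool_def
          if_distrib[of "\<lambda>a. a ^ _"] cong: if_cong)
    hence "(nrm n ((mat_app n M ^^ p) (unit_fun j)))\<^sup>2 \<le> (S ^ p)\<^sup>2"
      using iter[of p "unit_fun j"] by (intro power_mono) (auto simp: L2_set_nonneg)
    thus ?thesis by (simp add: power_mult[symmetric] mult.commute)
  qed
  hence "mat_trace n (mat_pow n M (2 * p)) \<le> (\<Sum>j<n. S ^ (2 * p))"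
    unfolding mat_trace_even_pow[OF assms(1)] by (intro sum_mono) auto
  thus ?thesis by simp
qed

text \<open>The trace is the squared Frobenius norm of the \<open>p\<close>-th power, which bounds
  its operator norm by Cauchy-Schwarz in each row.\<close>

lemma nrm_funpow_mat_app_square_le:
  assumes "sym_mat n M"
  shows "(nrm n ((mat_app n M ^^ p) x))\<^sup>2 \<le> mat_trace n (mat_pow n M (2 * p)) * (nrm n x)\<^sup>2"
proof -
  have "(nrm n ((mat_app n M ^^ p) x))\<^sup>2 = (\<Sum>i<n. (\<Sum>j<n. mat_pow n M p i j * x j)\<^sup>2)"
    unfolding nrm_square dot_def by (simp add: funpow_mat_app power2_eq_square)
  also have "\<dots> \<le> (\<Sum>i<n. (\<Sum>j<n. (mat_pow n M p i j)\<^sup>2) * (\<Sum>j<n. (x j)\<^sup>2))"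
    by (intro sum_mono Cauchy_Schwarz_ineq_sum)
  also have "\<dots> = (\<Sum>i<n. \<Sum>j<n. (mat_pow n M p i j)\<^sup>2) * (nrm n x)\<^sup>2"
    unfolding nrm_square dot_def by (simp add: power2_eq_square sum_distrib_right)
  also have "(\<Sum>i<n. \<Sum>j<n. (mat_pow n M p i j)\<^sup>2)
      = (\<Sum>j<n. \<Sum>i<n. ((mat_app n M ^^ p) (unit_fun j) i)\<^sup>2)"
    by (subst sum.swap) (simp add: mat_pow_eq_funpow_unit)
  also have "\<dots> = mat_trace n (mat_pow n M (2 * p))"
    unfolding mat_trace_even_pow[OF assms] nrm_square dot_def by (simp add: power2_eq_square)
  finally show ?thesis .
qed

text \<open>
  For symmetric \<open>M\<close> the sequence \<open>\<parallel>M\<^sup>k x\<parallel>\<close> is log-convex, so its growth from \<open>k = 0\<close> to \<open>k = 1\<close>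
  bounds its growth up to \<open>k = m\<close> from below. This replaces the spectral theorem.
\<close>
lemma nrm_mat_app_power_le:
  assumes "sym_mat n M"
  shows "nrm n (mat_app n M x) ^ m * nrm n x \<le> nrm n x ^ m * nrm n ((mat_app n M ^^ m) x)"
proof -
  define a where "a k = nrm n ((mat_app n M ^^ k) x)" for k
  have a_nonneg: "0 \<le> a k" for k by (simp add: a_def L2_set_nonneg)
  \<comment> \<open>Symmetry turns the square into the inner product of the \<open>k\<close>-th and
    the \<open>k + 2\<close>-nd iterate; then Cauchy-Schwarz.\<close>
  have log_convex: "(a (Suc k))\<^sup>2 \<le> a k * a (Suc (Suc k))" for k
    using dot_le_nrm[of n "(mat_app n M ^^ k) x" "(mat_app n M ^^ Suc (Suc k)) x"]
    by (simp add: a_def nrm_square dot_mat_app[OF assms])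
  \<comment> \<open>The first growth ratio is the smallest one, written without quotients since
    iterates may vanish.\<close>
  have ratio: "a 1 * a k \<le> a 0 * a (Suc k)" for k
  proof (induction k)
    case (Suc k)
    show ?case
    proof (cases "a (Suc k) = 0")
      case False
      hence pos: "0 < a (Suc k)" using a_nonneg[of "Suc k"] by simp
      have "a 1 * a (Suc k) * a (Suc k) \<le> a 1 * a k * a (Suc (Suc k))"
        using mult_left_mono[OF log_convex[of k] a_nonneg[of 1]]
        by (simp add: power2_eq_square mult.assoc)
      also have "\<dots> \<le> a 0 * a (Suc k) * a (Suc (Suc k))"
        using Suc a_nonneg by (intro mult_right_mono)
      finally have "a 1 * a (Suc k) * a (Suc k) \<le> a 0 * a (Suc (Suc k)) * a (Suc k)"
        by (simp add: mult_ac)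
      thus ?thesis using pos by simp
    qed (simp add: a_nonneg)
  qed simp
  have "a 1 ^ m * a 0 \<le> a 0 ^ m * a m"
  proof (induction m)
    case (Suc m)
    have "a 1 ^ Suc m * a 0 \<le> a 1 * (a 0 ^ m * a m)"
      using mult_left_mono[OF Suc a_nonneg[of 1]] by (simp add: mult_ac)
    also have "\<dots> = a 0 ^ m * (a 1 * a m)" by simp
    also have "\<dots> \<le> a 0 ^ m * (a 0 * a (Suc m))"
      using ratio a_nonneg by (intro mult_left_mono) auto
    finally show ?case by (simp add: mult_ac)
  qed simp
  thus ?thesis by (simp add: a_def)
qed

text \<open>The growth bound relates one application of the matrix to \<open>p\<close> applications,
  and the trace controls the latter. Squaring produces the exponent \<open>2 * p\<close>.\<close>

lemma nrm_mat_app_le_trace: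
  assumes "sym_mat n M" and "nrm n x \<noteq> 0"
  shows "(nrm n (mat_app n M x) / nrm n x) ^ (2 * p) \<le> mat_trace n (mat_pow n M (2 * p))"
proof -
  define a where "a = nrm n x"
  have a: "0 < a" using assms(2) L2_set_nonneg[of x "{..<n}"] by (auto simp: a_def less_le)
  have "(nrm n (mat_app n M x) ^ p * a)\<^sup>2 \<le> (a ^ p * nrm n ((mat_app n M ^^ p) x))\<^sup>2"
    unfolding a_def by (intro power_mono nrm_mat_app_power_le assms) (simp add: L2_set_nonneg)
  also have "\<dots> = (a ^ p)\<^sup>2 * (nrm n ((mat_app n M ^^ p) x))\<^sup>2"
    by (simp add: power_mult_distrib)
  also have "\<dots> \<le> (a ^ p)\<^sup>2 * (mat_trace n (mat_pow n M (2 * p)) * a\<^sup>2)"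
    unfolding a_def by (intro mult_left_mono nrm_funpow_mat_app_square_le assms) simp
  finally have "nrm n (mat_app n M x) ^ (2 * p) * a\<^sup>2 \<le> mat_trace n (mat_pow n M (2 * p)) * a ^ (2 * p) * a\<^sup>2"
    by (simp add: power_mult_distrib power_mult[symmetric] mult_ac)
  hence "nrm n (mat_app n M x) ^ (2 * p) \<le> mat_trace n (mat_pow n M (2 * p)) * a ^ (2 * p)"
    using a by simp
  thus ?thesis using a by (simp add: a_def[symmetric] power_divide divide_le_eq)
qed

section \<open>An integer lattice net and its size\<close>

text \<open>The integer points of the ball of radius \<open>2 * sqrt R\<close>: at this scale the
  grid of width 1 comes within half the radius of every point of the sphere. The box makes
  finiteness immediate and embeds the net in a product set, over which sums factorise.\<close>

definition lattice_net :: "nat \<Rightarrow> (nat \<Rightarrow> int) set" where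
  "lattice_net R = {z \<in> {..<R} \<rightarrow>\<^sub>E {- int (4 * R)..int (4 * R)}. (\<Sum>i<R. (real_of_int (z i))\<^sup>2) \<le> 4 * real R}"

lemma finite_lattice_net: "finite (lattice_net R)"
  unfolding lattice_net_def by (rule finite_subset[of _ "{..<R} \<rightarrow>\<^sub>E {- int (4 * R)..int (4 * R)}"])
    (auto intro!: finite_PiE)

lemma abs_le_square_int: "\<bar>k\<bar> \<le> k\<^sup>2" for k :: int
proof (cases "k = 0")
  case False
  hence "\<bar>k\<bar> * 1 \<le> \<bar>k\<bar> * \<bar>k\<bar>" by (intro mult_left_mono) auto
  thus ?thesis by (simp add: power2_eq_square)
qed simp

text \<open>
  Rounding towards zero moves each coordinate by at most 1, hence \<open>x\<close> by at most \<open>\<surd>R\<close>, half its norm.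
\<close>
lemma lattice_net_approx:
  fixes x :: "nat \<Rightarrow> real"
  assumes "(\<Sum>i<R. (x i)\<^sup>2) = 4 * real R"
  obtains z where "z \<in> lattice_net R" "(\<Sum>i<R. (x i - real_of_int (z i))\<^sup>2) \<le> real R"
proof -
  define w where "w i = (if 0 \<le> x i then \<lfloor>x i\<rfloor> else \<lceil>x i\<rceil>)" for i
  have w_le: "\<bar>real_of_int (w i)\<bar> \<le> \<bar>x i\<bar>" and w_diff: "\<bar>x i - real_of_int (w i)\<bar> \<le> 1" for i
    unfolding w_def by (auto split: if_splits) linarith+
  have sq_le: "(real_of_int (w i))\<^sup>2 \<le> (x i)\<^sup>2" for i
    using w_le[of i] by (simp add: abs_le_square_iff)
  have "(\<Sum>i<R. (real_of_int (w i))\<^sup>2) \<le> (\<Sum>i<R. (x i)\<^sup>2)"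
    by (intro sum_mono sq_le)
  hence sum_w: "(\<Sum>i<R. (real_of_int (w i))\<^sup>2) \<le> 4 * real R"
    using assms by simp
  have "w i \<in> {- int (4 * R)..int (4 * R)}" if "i < R" for i
  proof -
    have "(real_of_int (w i))\<^sup>2 \<le> (\<Sum>i<R. (real_of_int (w i))\<^sup>2)"
      using that by (intro member_le_sum) auto
    hence "(real_of_int (w i))\<^sup>2 \<le> 4 * real R" using sum_w by linarith
    hence "(w i)\<^sup>2 \<le> int (4 * R)"
      by (metis (mono_tags) of_int_le_iff of_int_of_nat_eq of_int_power of_nat_mult of_nat_numeral)
    hence "\<bar>w i\<bar> \<le> int (4 * R)" using abs_le_square_int[of "w i"] by linarith
    thus ?thesis by auto
  qed
  hence "restrict w {..<R} \<in> lattice_net R"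
    using sum_w by (auto simp: lattice_net_def)
  moreover have "(\<Sum>i<R. (x i - real_of_int (w i))\<^sup>2) \<le> (\<Sum>i<R. 1)"
    using w_diff by (intro sum_mono) (simp add: abs_square_le_1)
  ultimately show ?thesis by (intro that[of "restrict w {..<R}"]) auto
qed

text \<open>The two-sided geometric series stays below 3, which becomes the factor per coordinate in
  the size of the net.\<close>

lemma sum_half_power_abs: "(\<Sum>k=-int m..int m. (1/2::real) ^ nat \<bar>k\<bar>) = 3 - 2 * (1/2) ^ m"
proof (induction m)
  case (Suc m)
  have "{-int (Suc m)..int (Suc m)} = insert (-int (Suc m)) (insert (int (Suc m)) {-int m..int m})"
    by auto
  thus ?case using Suc by (simp add: nat_add_distrib)
qed simp

text \<open>Chernoff-style count: weight each point \<open>z\<close> by \<open>exp (- \<parallel>z\<parallel>\<^sup>2)\<close>, which factorises over the coordinates.\<close>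
lemma card_lattice_net: "real (card (lattice_net R)) \<le> (3 * exp 4) ^ R"
proof -
  let ?I = "{- int (4 * R)..int (4 * R)}"
  have "exp (- 4 * real R) * real (card (lattice_net R)) = (\<Sum>z\<in>lattice_net R. exp (- 4 * real R))"
    by simp
  also have "\<dots> \<le> (\<Sum>z\<in>lattice_net R. \<Prod>i<R. exp (- (real_of_int (z i))\<^sup>2))"
    by (intro sum_mono) (auto simp: lattice_net_def exp_sum[symmetric] sum_negf)
  also have "\<dots> \<le> (\<Sum>z\<in>{..<R} \<rightarrow>\<^sub>E ?I. \<Prod>i<R. exp (- (real_of_int (z i))\<^sup>2))"
    by (intro sum_mono2 finite_PiE prod_nonneg) (auto simp: lattice_net_def)
  also have "\<dots> = (\<Prod>i<R. \<Sum>k\<in>?I. exp (- (real_of_int k)\<^sup>2))"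
    by (subst prod_sum_PiE) auto
  also have "\<dots> \<le> (\<Prod>i<R. 3)"
  proof (intro prod_mono conjI sum_nonneg)
    have "exp (- (real_of_int k)\<^sup>2) \<le> (1/2) ^ nat \<bar>k\<bar>" for k
    proof -
      have "real (nat \<bar>k\<bar>) \<le> (real_of_int k)\<^sup>2"
      proof -
        have "real_of_int \<bar>k\<bar> \<le> real_of_int (k\<^sup>2)"
          using abs_le_square_int[of k] by (simp only: of_int_le_iff)
        thus ?thesis by simp
      qed
      hence "exp (- (real_of_int k)\<^sup>2) \<le> exp (- real (nat \<bar>k\<bar>))" by simp
      also have "\<dots> = exp (- 1) ^ nat \<bar>k\<bar>" by (simp add: exp_of_nat_mult[symmetric])
      \<comment> \<open>This is \<open>exp 1\<close> being at least 2.\<close>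
      also have "\<dots> \<le> (1/2) ^ nat \<bar>k\<bar>"
        using exp_ge_add_one_self[of 1] by (intro power_mono) (auto simp: exp_minus field_simps)
      finally show ?thesis .
    qed
    hence "(\<Sum>k\<in>?I. exp (- (real_of_int k)\<^sup>2)) \<le> (\<Sum>k\<in>?I. (1/2) ^ nat \<bar>k\<bar>)"
      by (intro sum_mono)
    also have "\<dots> \<le> 3" by (subst sum_half_power_abs) simp
    finally show "(\<Sum>k\<in>?I. exp (- (real_of_int k)\<^sup>2)) \<le> 3" .
  qed auto
  finally have "exp (- 4 * real R) * real (card (lattice_net R)) \<le> 3 ^ R" by simp
  hence "real (card (lattice_net R)) \<le> 3 ^ R * exp (4 * real R)"
    by (simp add: exp_minus field_simps)
  also have "exp (4 * real R) = exp 4 ^ R" by (simp add: exp_of_nat_mult mult.commute)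
  finally show ?thesis by (simp add: power_mult_distrib)
qed

section \<open>From the net to the operator norm\<close>

lemma nrm_scale: "nrm n (\<lambda>i. c * x i) = \<bar>c\<bar> * nrm n x"
proof -
  have "(nrm n (\<lambda>i. c * x i))\<^sup>2 = (\<bar>c\<bar> * nrm n x)\<^sup>2"
    unfolding power_mult_distrib nrm_square dot_def sum_distrib_left
    by (intro sum.cong refl) (simp add: power2_eq_square)
  thus ?thesis by (rule power2_eq_imp_eq) (auto simp: L2_set_nonneg)
qed

lemma mat_app_scale: "mat_app n M (\<lambda>i. c * x i) = (\<lambda>i. c * mat_app n M x i)"
  by (simp add: fun_eq_iff mat_app_def sum_distrib_left mult_ac)

lemma mat_app_add: "mat_app n M (\<lambda>i. x i + y i) = (\<lambda>i. mat_app n M x i + mat_app n M y i)"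
  by (simp add: fun_eq_iff mat_app_def sum.distrib algebra_simps)

lemma nrm_mat_app_le_frobenius:
  "nrm n (mat_app n M x) \<le> sqrt (\<Sum>i<n. \<Sum>j<n. (M i j)\<^sup>2) * nrm n x"
proof -
  have "(nrm n (mat_app n M x))\<^sup>2 = (\<Sum>i<n. (\<Sum>j<n. M i j * x j)\<^sup>2)"
    unfolding nrm_square dot_def mat_app_def by (simp add: power2_eq_square)
  also have "\<dots> \<le> (\<Sum>i<n. (\<Sum>j<n. (M i j)\<^sup>2) * (\<Sum>j<n. (x j)\<^sup>2))"
    by (intro sum_mono Cauchy_Schwarz_ineq_sum)
  also have "\<dots> = (\<Sum>i<n. \<Sum>j<n. (M i j)\<^sup>2) * (nrm n x)\<^sup>2"
    unfolding nrm_square dot_def by (simp add: power2_eq_square sum_distrib_right)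
  also have "\<dots> = (sqrt (\<Sum>i<n. \<Sum>j<n. (M i j)\<^sup>2) * nrm n x)\<^sup>2"
    by (simp add: power_mult_distrib sum_nonneg)
  finally show ?thesis by (rule power2_le_imp_le) (simp add: L2_set_nonneg sum_nonneg)
qed

text \<open>Rescaling puts \<open>x\<close> on the sphere of radius \<open>2 * sqrt R\<close>, where
  the net approximates up to half the radius.\<close>

lemma lattice_net_approx_direction:
  assumes "nrm R x \<noteq> 0"
  obtains z where "z \<in> lattice_net R"
    "nrm R (\<lambda>i. 2 * sqrt R / nrm R x * x i - real_of_int (z i)) \<le> sqrt R"
proof -
  have "(\<Sum>i<R. (2 * sqrt R / nrm R x * x i)\<^sup>2) = (nrm R (\<lambda>i. 2 * sqrt R / nrm R x * x i))\<^sup>2"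
    unfolding nrm_square dot_def by (simp add: power2_eq_square)
  also have "\<dots> = 4 * real R"
    using assms unfolding nrm_scale by (simp add: L2_set_nonneg power_mult_distrib)
  finally obtain z where z: "z \<in> lattice_net R"
    "(\<Sum>i<R. (2 * sqrt R / nrm R x * x i - real_of_int (z i))\<^sup>2) \<le> real R"
    by (rule lattice_net_approx)
  thus ?thesis by (intro that[of z]) (auto simp: L2_set_def)
qed

lemma zero_in_lattice_net: "(\<lambda>i\<in>{..<R}. 0) \<in> lattice_net R"
  by (auto simp: lattice_net_def)

text \<open>The net is used once for each argument of the bilinear form. Approximating the left
  vector bounds the images of net points; approximating the right one bounds all images, in terms of
  any bound already known. Each use loses a factor 2.\<close>

lemma nrm_mat_app_le_lattice_net:
  assumes "0 < R"
    and B: "\<And>y z. y \<in> lattice_net R \<Longrightarrow> z \<in> lattice_net R \<Longrightarrow>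
      dot R (\<lambda>i. real_of_int (y i)) (mat_app R M (\<lambda>i. real_of_int (z i))) \<le> B"
  shows "nrm R (mat_app R M x) \<le> B / R * nrm R x"
proof -
  have sR: "0 < sqrt R" using assms by simp
  have B0: "0 \<le> B"
    using B[OF zero_in_lattice_net zero_in_lattice_net] by (simp add: dot_def)
  have net: "sqrt R * nrm R (mat_app R M (\<lambda>i. real_of_int (z i))) \<le> B" if z: "z \<in> lattice_net R" for z
  proof -
    define u where "u = mat_app R M (\<lambda>i. real_of_int (z i))"
    show ?thesis
    proof (cases "nrm R u = 0")
      case False
      define c where "c = 2 * sqrt R / nrm R u"
      obtain y where y: "y \<in> lattice_net R" "nrm R (\<lambda>i. c * u i - real_of_int (y i)) \<le> sqrt R"
        unfolding c_def by (rule lattice_net_approx_direction[OF False])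
      \<comment> \<open>The left side is \<open>2 * sqrt R\<close> times the norm of
        \<open>u\<close> and the approximation error costs at most half of that, so it can be
        absorbed.\<close>
      have "c * dot R u u = dot R (\<lambda>i. real_of_int (y i)) u + dot R (\<lambda>i. c * u i - real_of_int (y i)) u"
        by (simp add: dot_def sum_distrib_left sum.distrib[symmetric] algebra_simps)
      also have "\<dots> \<le> B + nrm R (\<lambda>i. c * u i - real_of_int (y i)) * nrm R u"
        unfolding u_def by (intro add_mono B y z dot_le_nrm)
      also have "\<dots> \<le> B + sqrt R * nrm R u"
        using y by (intro add_left_mono mult_right_mono) (auto simp: L2_set_nonneg)
      also have "c * dot R u u = 2 * sqrt R * nrm R u"
        using False by (simp add: c_def nrm_square[symmetric] power2_eq_square)
      finally show ?thesis by (simp add: u_def)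
    qed (use B0 in \<open>simp add: u_def\<close>)
  qed
  txt \<open>If \<open>s\<close> bounds the operator norm, then so does \<open>B / (2R) + s / 2\<close>; hence the least bound is at most \<open>B / R\<close>.\<close>
  define S where "S = {s. 0 \<le> s \<and> (\<forall>x. nrm R (mat_app R M x) \<le> s * nrm R x)}"
  \<comment> \<open>The Frobenius norm shows that some finite bound exists, so that the infimum of
    \<open>S\<close> is meaningful.\<close>
  have "sqrt (\<Sum>i<R. \<Sum>j<R. (M i j)\<^sup>2) \<in> S"
    using nrm_mat_app_le_frobenius[of R M] by (simp add: S_def sum_nonneg)
  hence S_ne: "S \<noteq> {}" by blast
  have S_bdd: "bdd_below S" by (auto simp: S_def)
  have step: "B / (2 * R) + s / 2 \<in> S" if s: "s \<in> S" for s
  proof -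
    have "nrm R (mat_app R M x) \<le> (B / (2 * R) + s / 2) * nrm R x" for x
    proof (cases "nrm R x = 0")
      case True
      have "nrm R (mat_app R M x) \<le> s * nrm R x" using s by (simp add: S_def)
      with True show ?thesis by simp
    next
      case False
      hence pos: "0 < nrm R x" by (simp add: less_le L2_set_nonneg)
      define c where "c = 2 * sqrt R / nrm R x"
      have c: "0 < c" using pos sR by (simp add: c_def)
      obtain z where z: "z \<in> lattice_net R" "nrm R (\<lambda>i. c * x i - real_of_int (z i)) \<le> sqrt R"
        unfolding c_def by (rule lattice_net_approx_direction[OF False])
      have "c * nrm R (mat_app R M x) = nrm R (mat_app R M (\<lambda>i. real_of_int (z i) + (c * x i - real_of_int (z i))))"
        using c by (simp add: mat_app_scale nrm_scale)
      also have "\<dots> \<le> nrm R (mat_app R M (\<lambda>i. real_of_int (z i)))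
          + nrm R (mat_app R M (\<lambda>i. c * x i - real_of_int (z i)))"
        unfolding mat_app_add by (rule L2_set_triangle_ineq)
      also have "\<dots> \<le> B / sqrt R + s * sqrt R"
      proof (intro add_mono)
        show "nrm R (mat_app R M (\<lambda>i. real_of_int (z i))) \<le> B / sqrt R"
          using net[OF z(1)] sR by (simp add: field_simps)
        have "nrm R (mat_app R M (\<lambda>i. c * x i - real_of_int (z i)))
            \<le> s * nrm R (\<lambda>i. c * x i - real_of_int (z i))"
          using s unfolding S_def by blast
        also have "\<dots> \<le> s * sqrt R" using s z by (intro mult_left_mono) (auto simp: S_def)
        finally show "nrm R (mat_app R M (\<lambda>i. c * x i - real_of_int (z i))) \<le> s * sqrt R" .
      qed
      finally have "2 * sqrt R * nrm R (mat_app R M x) \<le> (B / sqrt R + s * sqrt R) * nrm R x"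
        using pos by (simp add: c_def field_simps)
      hence "sqrt R * (2 * sqrt R * nrm R (mat_app R M x)) \<le> sqrt R * ((B / sqrt R + s * sqrt R) * nrm R x)"
        using sR by (intro mult_left_mono) auto
      also have "\<dots> = (B + s * (sqrt R * sqrt R)) * nrm R x"
        using sR by (simp add: field_simps)
      also have "sqrt R * (2 * sqrt R * nrm R (mat_app R M x))
          = 2 * (sqrt R * sqrt R) * nrm R (mat_app R M x)"
        by (simp only: mult_ac)
      finally have "2 * R * nrm R (mat_app R M x) \<le> (B + s * R) * nrm R x"
        by simp
      thus ?thesis using assms(1) by (simp add: field_simps)
    qed
    thus ?thesis using B0 s assms(1) by (auto simp: S_def)
  qed
  have "B / (2 * R) + s / 2 \<ge> Inf S" if "s \<in> S" for s
    using step[OF that] S_bdd by (rule cInf_lower)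
  hence "2 * (Inf S - B / (2 * R)) \<le> s" if "s \<in> S" for s
    using that by fastforce
  hence "2 * (Inf S - B / (2 * R)) \<le> Inf S"
    by (rule cInf_greatest[OF S_ne])
  hence Inf_le: "Inf S \<le> B / R" by simp
  show ?thesis
  proof (cases "nrm R x = 0")
    case True
    obtain s where "s \<in> S" using S_ne by blast
    hence "nrm R (mat_app R M x) \<le> s * nrm R x" by (simp add: S_def)
    with True show ?thesis by simp
  next
    case False
    hence pos: "0 < nrm R x" by (simp add: less_le L2_set_nonneg)
    have "nrm R (mat_app R M x) / nrm R x \<le> Inf S"
      using pos by (intro cInf_greatest[OF S_ne]) (auto simp: S_def divide_le_eq)
    also note Inf_le
    finally show ?thesis using pos by (simp add: divide_le_eq)
  qed
qed

section \<open>The spectral norm and even traces\<close>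

text \<open>Vectors of norm 0 contribute \<open>0 / 0 = 0\<close> to the supremum;
  \<open>0 \<le> t\<close> covers them.\<close>

lemma spectral_norm_mat_le:
  assumes "0 \<le> t" and "\<And>x. nrm n x \<noteq> 0 \<Longrightarrow> nrm n (mat_app n M x) / nrm n x \<le> t"
  shows "spectral_norm (mat n n (\<lambda>(i, j). M i j)) \<le> t"
  unfolding spectral_norm_def
proof (rule cSUP_least)
  show "carrier_vec (dim_col (mat n n (\<lambda>(i, j). M i j))) \<noteq> ({} :: real Matrix.vec set)"
    using zero_carrier_vec by blast
  fix x :: "real Matrix.vec"
  assume "x \<in> carrier_vec (dim_col (mat n n (\<lambda>(i, j). M i j)))"
  hence x: "dim_vec x = n" by simp
  have "euclidean_norm (mat n n (\<lambda>(i, j). M i j) *\<^sub>v x) = nrm n (mat_app n M (vec_index x))"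
    unfolding euclidean_norm_def using x
    by (auto intro!: L2_set_cong simp: mat_app_def scalar_prod_def atLeast0LessThan)
  thus "euclidean_norm (mat n n (\<lambda>(i, j). M i j) *\<^sub>v x) / euclidean_norm x \<le> t"
    using assms x by (cases "nrm n (vec_index x) = 0") (auto simp: euclidean_norm_def)
qed

lemma spectral_norm_le_trace:
  assumes "sym_mat n M" and "0 \<le> t" and "0 < p" and "mat_trace n (mat_pow n M (2 * p)) \<le> t ^ (2 * p)"
  shows "spectral_norm (mat n n (\<lambda>(i, j). M i j)) \<le> t"
proof (intro spectral_norm_mat_le assms)
  fix x assume "nrm n x \<noteq> 0"
  from nrm_mat_app_le_trace[OF assms(1) this, of p]
  have "(nrm n (mat_app n M x) / nrm n x) ^ Suc (2 * p - 1) \<le> t ^ Suc (2 * p - 1)"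
    using assms(3,4) by simp
  thus "nrm n (mat_app n M x) / nrm n x \<le> t"
    using assms(2) by (rule power_le_imp_le_base)
qed

section \<open>Closed walks and their equality patterns\<close>

text \<open>A walk of \<open>L\<close> steps lists \<open>L + 1\<close> nodes, so a closed one
  repeats its first node at time \<open>L\<close>. Extensionality makes the set finite.\<close>

definition walks :: "nat \<Rightarrow> nat \<Rightarrow> (nat \<Rightarrow> nat) set" where
  "walks n L = {..L} \<rightarrow>\<^sub>E {..<n}"

text \<open>An unordered edge is encoded by its increasing pair, the kind of index for which
  \<open>independent_edges\<close> gives independence.\<close>

definition edge :: "nat \<Rightarrow> nat \<Rightarrow> nat \<times> nat" where
  "edge i j = (min i j, max i j)"

abbreviation step :: "(nat \<Rightarrow> nat) \<Rightarrow> nat \<Rightarrow> nat \<times> nat" where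
  "step w t \<equiv> edge (w t) (w (Suc t))"

definition loopfree_closed :: "nat \<Rightarrow> (nat \<Rightarrow> nat) \<Rightarrow> bool" where
  "loopfree_closed L w \<longleftrightarrow> w L = w 0 \<and> (\<forall>t<L. w t \<noteq> w (Suc t))"

text \<open>These are the walks that can survive taking expectations of independent centred entries
  with zero diagonal.\<close>

definition repeating :: "nat \<Rightarrow> (nat \<Rightarrow> nat) \<Rightarrow> bool" where
  "repeating L w \<longleftrightarrow> loopfree_closed L w \<and> (\<forall>t<L. \<exists>s<L. s \<noteq> t \<and> step w s = step w t)"

text \<open>Each time is sent to the first time at which its node is visited. This picks a canonical
  walk, with times as nodes, from each class of walks with the same coincidences.\<close>

definition pattern :: "nat \<Rightarrow> (nat \<Rightarrow> nat) \<Rightarrow> nat \<Rightarrow> nat" where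
  "pattern L w = (\<lambda>t\<in>{..L}. LEAST s. s \<le> L \<and> w s = w t)"

lemma edge_eq_iff: "edge a b = edge c d \<longleftrightarrow> a = c \<and> b = d \<or> a = d \<and> b = c"
  by (auto simp: edge_def min_def max_def)

lemma finite_walks: "finite (walks n L)"
  unfolding walks_def by (intro finite_PiE) auto

lemma sum_walks_Suc:
  "(\<Sum>w\<in>walks n (Suc L). f w) = (\<Sum>w\<in>walks n L. \<Sum>j<n. f (w(Suc L := j)))"
proof -
  have "(\<Sum>w\<in>walks n (Suc L). f w)
      = (\<Sum>w\<in>(\<lambda>(j, w). w(Suc L := j)) ` ({..<n} \<times> walks n L). f w)"
    by (simp add: walks_def atMost_Suc PiE_insert_eq)
  also have "\<dots> = (\<Sum>(j, w)\<in>{..<n} \<times> walks n L. f (w(Suc L := j)))"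
    using inj_combinator[of "Suc L" "{..L}" "\<lambda>_. {..<n}"]
    by (subst sum.reindex) (auto simp: walks_def case_prod_unfold)
  also have "\<dots> = (\<Sum>j<n. \<Sum>w\<in>walks n L. f (w(Suc L := j)))"
    by (simp add: sum.cartesian_product)
  also have "\<dots> = (\<Sum>w\<in>walks n L. \<Sum>j<n. f (w(Suc L := j)))"
    by (rule sum.swap)
  finally show ?thesis .
qed

text \<open>The weight \<open>F\<close> of the two ends is there for the induction: dropping the
  last step replaces \<open>F\<close> by its product with the transpose of \<open>M\<close>.\<close>

lemma sum_walks_mat_pow:
  "(\<Sum>w\<in>walks n L. F (w 0) (w L) * (\<Prod>t<L. M (w t) (w (Suc t))))
    = (\<Sum>i<n. \<Sum>j<n. F i j * mat_pow n M L i j)"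
proof (induction L arbitrary: F)
  case 0
  have "walks n 0 = (\<lambda>j. (\<lambda>_. undefined)(0 := j)) ` {..<n}"
    using PiE_insert_eq[of 0 "{}" "\<lambda>_. {..<n}"] by (auto simp: walks_def)
  moreover have "inj_on (\<lambda>j. (\<lambda>_::nat. undefined)(0 := j)) {..<n}"
    by (auto simp: inj_on_def dest: fun_cong[of _ _ 0])
  ultimately have "(\<Sum>w\<in>walks n 0. F (w 0) (w 0)) = (\<Sum>i<n. F i i)"
    by (simp add: sum.reindex)
  thus ?case
    by (simp add: of_bool_def if_distrib[of "\<lambda>a. _ * a"] cong: if_cong)
next
  case (Suc L)
  have "(\<Sum>w\<in>walks n (Suc L). F (w 0) (w (Suc L)) * (\<Prod>t<Suc L. M (w t) (w (Suc t))))
      = (\<Sum>w\<in>walks n L. (\<Sum>j<n. F (w 0) j * M (w L) j) * (\<Prod>t<L. M (w t) (w (Suc t))))"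
    unfolding sum_walks_Suc
  proof (intro sum.cong refl)
    fix w
    show "(\<Sum>j<n. F ((w(Suc L := j)) 0) ((w(Suc L := j)) (Suc L)) *
           (\<Prod>t<Suc L. M ((w(Suc L := j)) t) ((w(Suc L := j)) (Suc t))))
       = (\<Sum>j<n. F (w 0) j * M (w L) j) * (\<Prod>t<L. M (w t) (w (Suc t)))"
      unfolding sum_distrib_right by (intro sum.cong refl) simp
  qed
  also have "\<dots> = (\<Sum>i<n. \<Sum>l<n. (\<Sum>j<n. F i j * M l j) * mat_pow n M L i l)"
    by (rule Suc)
  also have "\<dots> = (\<Sum>i<n. \<Sum>j<n. \<Sum>l<n. F i j * M l j * mat_pow n M L i l)"
    unfolding sum_distrib_right by (intro sum.cong refl sum.swap)
  also have "\<dots> = (\<Sum>i<n. \<Sum>j<n. F i j * mat_pow n M (Suc L) i j)"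
    by (simp add: sum_distrib_left mult_ac)
  finally show ?case .
qed

lemma mat_trace_mat_pow:
  "mat_trace n (mat_pow n M L)
    = (\<Sum>w\<in>walks n L. of_bool (w L = w 0) * (\<Prod>t<L. M (w t) (w (Suc t))))"
  unfolding sum_walks_mat_pow[of "\<lambda>i j. of_bool (j = i)"] mat_trace_def
  by (intro sum.cong refl) (simp add: of_bool_def if_distrib[of "\<lambda>a. a * _"] cong: if_cong)

lemma pattern_le: "t \<le> L \<Longrightarrow> pattern L w t \<le> L"
  unfolding pattern_def using LeastI[of "\<lambda>s. s \<le> L \<and> w s = w t" t] by simp

lemma pattern_eq_iff:
  assumes "s \<le> L" "t \<le> L"
  shows "pattern L w s = pattern L w t \<longleftrightarrow> w s = w t"
proof
  have *: "w (pattern L w u) = w u" if "u \<le> L" for u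
    unfolding pattern_def using that LeastI[of "\<lambda>s. s \<le> L \<and> w s = w u" u] by simp
  show "w s = w t" if "pattern L w s = pattern L w t"
    using *[OF assms(1)] *[OF assms(2)] that by simp
qed (use assms in \<open>simp add: pattern_def\<close>)

lemma pattern_cong:
  assumes "\<And>s t. s \<le> L \<Longrightarrow> t \<le> L \<Longrightarrow> w s = w t \<longleftrightarrow> w' s = w' t"
  shows "pattern L w = pattern L w'"
  unfolding pattern_def by (intro ext) (auto simp: restrict_def assms intro!: arg_cong[of _ _ Least])

lemma pattern_pattern: "pattern L (pattern L w) = pattern L w"
  by (intro pattern_cong) (simp add: pattern_eq_iff)

lemma pattern_in_PiE: "pattern L w \<in> {..L} \<rightarrow>\<^sub>E {..L}"
  using pattern_le by (auto simp: pattern_def restrict_def PiE_iff extensional_def)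

lemma loopfree_closed_pattern: "loopfree_closed L (pattern L w) \<longleftrightarrow> loopfree_closed L w"
  unfolding loopfree_closed_def by (simp add: pattern_eq_iff)

lemma repeating_pattern: "repeating L (pattern L w) \<longleftrightarrow> repeating L w"
proof -
  have "step (pattern L w) s = step (pattern L w) t \<longleftrightarrow> step w s = step w t" if "s < L" "t < L" for s t
    using that by (simp add: edge_eq_iff pattern_eq_iff)
  thus ?thesis unfolding repeating_def loopfree_closed_pattern by (metis (no_types, lifting))
qed

text \<open>The walk itself is a bijection from first-visit times to visited nodes.\<close>

lemma card_image_pattern: "card (pattern L w ` {..L}) = card (w ` {..L})"
proof -
  have "bij_betw w (pattern L w ` {..L}) (w ` {..L})"
    unfolding bij_betw_def
  proof
    have *: "pattern L w u \<le> L" "w (pattern L w u) = w u" if "u \<le> L" for u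
      unfolding pattern_def using that LeastI[of "\<lambda>s. s \<le> L \<and> w s = w u" u] by simp_all
    show "inj_on w (pattern L w ` {..L})"
      by (auto simp: inj_on_def * pattern_eq_iff)
    show "w ` pattern L w ` {..L} = w ` {..L}"
      unfolding image_image by (intro image_cong refl) (simp add: *)
  qed
  thus ?thesis by (rule bij_betw_same_card)
qed

section \<open>Counting nodes, steps and walks of a given pattern\<close>

text \<open>The traversed graph is connected: a new node can only be reached by a step that has not
  been used before. The extra 1 is the starting node.\<close>

lemma card_vertices_le_card_steps: "card (w ` {..L}) \<le> card (step w ` {..<L}) + 1"
proof (induction L)
  case (Suc L)
  show ?case
  proof (cases "w (Suc L) \<in> w ` {..L}")
    case True
    hence "card (w ` {..Suc L}) = card (w ` {..L})" by (simp add: atMost_Suc insert_absorb)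
    also have "\<dots> \<le> card (step w ` {..<L}) + 1" by (rule Suc)
    also have "card (step w ` {..<L}) \<le> card (step w ` {..<Suc L})"
      by (intro card_mono image_mono) auto
    finally show ?thesis by simp
  next
    case False
    have "step w L \<notin> step w ` {..<L}"
    proof
      assume "step w L \<in> step w ` {..<L}"
      then obtain t where "t < L" "step w L = step w t" by auto
      hence "w (Suc L) \<in> w ` {..L}" by (auto simp: edge_eq_iff)
      with False show False ..
    qed
    thus ?thesis using Suc False by (simp add: atMost_Suc lessThan_Suc)
  qed
qed simp

text \<open>Double counting: the times are partitioned by the edge used, and every class has at
  least two elements.\<close>

lemma card_steps_repeating:
  assumes "repeating L w"
  shows "2 * card (step w ` {..<L}) \<le> L"
proof -
  have "(\<Sum>e\<in>step w ` {..<L}. 2) \<le> (\<Sum>e\<in>step w ` {..<L}. card {t \<in> {..<L}. step w t = e})"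
  proof (intro sum_mono)
    fix e assume "e \<in> step w ` {..<L}"
    then obtain t where t: "t < L" "e = step w t" by auto
    then obtain s where "s < L" "s \<noteq> t" "step w s = step w t"
      using assms by (auto simp: repeating_def)
    with t have "card {s, t} \<le> card {t \<in> {..<L}. step w t = e}" by (intro card_mono) auto
    with \<open>s \<noteq> t\<close> show "2 \<le> card {t \<in> {..<L}. step w t = e}" by simp
  qed
  also have "\<dots> = card {..<L}"
    using sum.image_gen[of "{..<L}" "\<lambda>_. 1::nat" "step w"] by simp
  finally show ?thesis by simp
qed

text \<open>Such a walk is determined by its values at the first-visit times, which form the image
  of \<open>\<sigma>\<close>.\<close>

lemma card_walks_with_pattern_le:
  assumes "pattern L \<sigma> = \<sigma>"
  shows "card {w \<in> walks n L. pattern L w = \<sigma>} \<le> n ^ card (\<sigma> ` {..L})"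
proof -
  have \<sigma>: "\<sigma> \<in> {..L} \<rightarrow>\<^sub>E {..L}" using pattern_in_PiE[of L \<sigma>] assms by simp
  have sub: "\<sigma> ` {..L} \<subseteq> {..L}" using \<sigma> by auto
  have inj: "inj_on (\<lambda>w. restrict w (\<sigma> ` {..L})) {w \<in> walks n L. pattern L w = \<sigma>}"
  proof (rule inj_onI)
    fix w w' assume w: "w \<in> {w \<in> walks n L. pattern L w = \<sigma>}"
      and w': "w' \<in> {w \<in> walks n L. pattern L w = \<sigma>}"
      and eq: "restrict w (\<sigma> ` {..L}) = restrict w' (\<sigma> ` {..L})"
    have at: "v t = v (\<sigma> t)" if "pattern L v = \<sigma>" "t \<le> L" for v t
      using that pattern_eq_iff[of t L "\<sigma> t" v] sub assms pattern_eq_iff[of t L "\<sigma> t" \<sigma>]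
        LeastI[of "\<lambda>s. s \<le> L \<and> v s = v t" t]
      by (auto simp: pattern_def)
    show "w = w'"
    proof (rule PiE_ext[of w "{..L}" "\<lambda>_. {..<n}" w'])
      fix t assume t: "t \<in> {..L}"
      have "w (\<sigma> t) = w' (\<sigma> t)" using fun_cong[OF eq, of "\<sigma> t"] t by simp
      thus "w t = w' t" using at[of w t] at[of w' t] t w w' by simp
    qed (use w w' in \<open>auto simp: walks_def\<close>)
  qed
  have "card {w \<in> walks n L. pattern L w = \<sigma>} \<le> card (\<sigma> ` {..L} \<rightarrow>\<^sub>E {..<n})"
    using sub by (intro card_inj_on_le[OF inj] finite_PiE) (auto simp: walks_def PiE_iff)
  thus ?thesis by (simp add: card_funcsetE)
qed

text \<open>Every injective assignment of nodes to first-visit times induces a different walk with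
  this pattern. With too few nodes, truncated subtraction makes the product 0.\<close>

lemma card_walks_with_pattern_ge:
  assumes "pattern L \<sigma> = \<sigma>"
  shows "(\<Prod>i<card (\<sigma> ` {..L}). n - i) \<le> card {w \<in> walks n L. pattern L w = \<sigma>}"
proof -
  let ?V = "\<sigma> ` {..L}"
  let ?H = "{h \<in> ?V \<rightarrow>\<^sub>E {..<n}. inj_on h ?V}"
  have inj: "inj_on (\<lambda>h. \<lambda>t\<in>{..L}. h (\<sigma> t)) ?H"
  proof (rule inj_onI)
    fix h h' assume h: "h \<in> ?H" "h' \<in> ?H" and eq: "(\<lambda>t\<in>{..L}. h (\<sigma> t)) = (\<lambda>t\<in>{..L}. h' (\<sigma> t))"
    have "h (\<sigma> t) = h' (\<sigma> t)" if "t \<le> L" for t using fun_cong[OF eq, of t] that by simp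
    thus "h = h'" using h by (intro PiE_ext[of h ?V "\<lambda>_. {..<n}" h']) auto
  qed
  have "pattern L (\<lambda>t\<in>{..L}. h (\<sigma> t)) = \<sigma>" if "h \<in> ?H" for h
  proof -
    have "pattern L (\<lambda>t\<in>{..L}. h (\<sigma> t)) = pattern L \<sigma>"
      using that by (intro pattern_cong) (auto simp: inj_on_def)
    with assms show ?thesis by simp
  qed
  moreover have "(\<lambda>t\<in>{..L}. h (\<sigma> t)) \<in> walks n L" if "h \<in> ?H" for h
    using that by (auto simp: walks_def)
  ultimately have "card ?H \<le> card {w \<in> walks n L. pattern L w = \<sigma>}"
    by (intro card_inj_on_le[OF inj]) (auto intro: finite_subset[OF _ finite_walks[of n L]])
  moreover have "card ?H = (\<Prod>i<card ?V. n - i)"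
    by (subst card_inj_on_subset_funcset) (auto simp: atLeast0LessThan)
  ultimately show ?thesis by simp
qed

text \<open>Both being \<open>repeating\<close> and the number of visited nodes depend only on the
  pattern, so the sum can be grouped by patterns.\<close>

lemma sum_repeating_walks:
  fixes g :: "nat \<Rightarrow> real"
  shows "(\<Sum>w | w \<in> walks n L \<and> repeating L w. g (card (w ` {..L})))
    = (\<Sum>\<sigma> | \<sigma> \<in> {..L} \<rightarrow>\<^sub>E {..L} \<and> pattern L \<sigma> = \<sigma> \<and> repeating L \<sigma>.
        card {w \<in> walks n L. pattern L w = \<sigma>} * g (card (\<sigma> ` {..L})))"
    (is "_ = (\<Sum>\<sigma>\<in>?S. _)")
proof -
  let ?W = "{w. w \<in> walks n L \<and> repeating L w}"
  have fin: "finite ?W" "finite ?S"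
    using finite_walks[of n L] finite_PiE[of "{..L}" "\<lambda>_. {..L}"] by auto
  have "(\<Sum>w\<in>?W. g (card (w ` {..L})))
      = (\<Sum>\<sigma>\<in>?S. \<Sum>w\<in>{w \<in> ?W. pattern L w = \<sigma>}. g (card (w ` {..L})))"
    using fin pattern_in_PiE[of L]
    by (intro sum.group[symmetric]) (auto simp: pattern_pattern repeating_pattern)
  also have "\<dots> = (\<Sum>\<sigma>\<in>?S. card {w \<in> walks n L. pattern L w = \<sigma>} * g (card (\<sigma> ` {..L})))"
  proof (intro sum.cong refl)
    fix \<sigma> assume \<sigma>: "\<sigma> \<in> ?S"
    have "{w \<in> ?W. pattern L w = \<sigma>} = {w \<in> walks n L. pattern L w = \<sigma>}"
      using \<sigma> repeating_pattern[of L] by auto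
    moreover have "(\<Sum>w\<in>{w \<in> walks n L. pattern L w = \<sigma>}. g (card (w ` {..L})))
        = (\<Sum>w\<in>{w \<in> walks n L. pattern L w = \<sigma>}. g (card (\<sigma> ` {..L})))"
      by (intro sum.cong refl) (metis (mono_tags, lifting) card_image_pattern mem_Collect_eq)
    ultimately show "(\<Sum>w\<in>{w \<in> ?W. pattern L w = \<sigma>}. g (card (w ` {..L})))
        = card {w \<in> walks n L. pattern L w = \<sigma>} * g (card (\<sigma> ` {..L}))" by simp
  qed
  finally show ?thesis .
qed

text \<open>The factor for \<open>i = 0\<close> is \<open>2 * p\<close>; the other
  \<open>v - 1\<close> have \<open>i \<le> p\<close> and so are at least \<open>p\<close>.\<close>

lemma falling_factorial_ge:
  assumes "0 < v" "v \<le> p + 1"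
  shows "2 * p * p ^ (v - 1) \<le> (\<Prod>i<v. 2 * p - i)"
proof -
  obtain u where u: "v = Suc u" using assms by (cases v) auto
  have "p ^ u = (\<Prod>i<u. p)" by simp
  also have "\<dots> \<le> (\<Prod>i<u. 2 * p - Suc i)"
    using assms u by (intro prod_mono) auto
  finally show ?thesis by (simp add: u prod.lessThan_Suc_shift del: prod.lessThan_Suc)
qed

text \<open>The patterns are the same for both sizes, so it suffices to compare one pattern at a
  time: the upper count for \<open>n\<close> nodes, weighted by powers of \<open>\<delta>\<close>,
  against the lower count for \<open>2 * p\<close> nodes.\<close>

lemma repeating_walks_comparison:
  fixes \<delta> :: real
  assumes "0 \<le> \<delta>" and "n * \<delta> \<le> p"
  shows "real (2 * p) * (\<Sum>w | w \<in> walks n (2 * p) \<and> repeating (2 * p) w. \<delta> ^ (card (w ` {..2 * p}) - 1))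
    \<le> real n * real (card {w. w \<in> walks (2 * p) (2 * p) \<and> repeating (2 * p) w})"
proof -
  let ?L = "2 * p"
  let ?S = "{\<sigma>. \<sigma> \<in> {..?L} \<rightarrow>\<^sub>E {..?L} \<and> pattern ?L \<sigma> = \<sigma> \<and> repeating ?L \<sigma>}"
  let ?c = "\<lambda>n \<sigma>. real (card {w \<in> walks n ?L. pattern ?L w = \<sigma>})"
  have "2 * p * (?c n \<sigma> * \<delta> ^ (card (\<sigma> ` {..?L}) - 1)) \<le> n * ?c ?L \<sigma>" if \<sigma>: "\<sigma> \<in> ?S" for \<sigma>
  proof -
    define v where "v = card (\<sigma> ` {..?L})"
    have v0: "0 < v" by (auto simp: v_def card_gt_0_iff)
    \<comment> \<open>A repeating walk of \<open>2 * p\<close> steps has at most \<open>p\<close>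
      distinct edges, hence at most \<open>p + 1\<close> nodes.\<close>
    have vp: "v \<le> p + 1"
      using card_vertices_le_card_steps[of \<sigma> ?L] card_steps_repeating[of ?L \<sigma>] \<sigma> by (auto simp: v_def)
    have "?c n \<sigma> \<le> real (n ^ v)"
      unfolding v_def of_nat_le_iff using \<sigma> by (intro card_walks_with_pattern_le) auto
    hence "?c n \<sigma> * \<delta> ^ (v - 1) \<le> real (n ^ v) * \<delta> ^ (v - 1)"
      using assms(1) by (intro mult_right_mono) auto
    also have "\<dots> = n * (n * \<delta>) ^ (v - 1)"
      using v0 by (cases v) (auto simp: power_mult_distrib)
    also have "\<dots> \<le> n * real p ^ (v - 1)"
      using assms by (intro mult_left_mono power_mono) auto
    finally have "2 * p * (?c n \<sigma> * \<delta> ^ (v - 1)) \<le> 2 * p * (n * real p ^ (v - 1))"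
      by (intro mult_left_mono) auto
    also have "\<dots> = n * real (2 * p * p ^ (v - 1))" by simp
    also have "\<dots> \<le> n * ?c ?L \<sigma>"
    proof (intro mult_left_mono of_nat_mono)
      have "2 * p * p ^ (v - 1) \<le> (\<Prod>i<v. 2 * p - i)" by (rule falling_factorial_ge[OF v0 vp])
      also have "\<dots> \<le> card {w \<in> walks ?L ?L. pattern ?L w = \<sigma>}"
        unfolding v_def using \<sigma> by (intro card_walks_with_pattern_ge) auto
      finally show "2 * p * p ^ (v - 1) \<le> card {w \<in> walks ?L ?L. pattern ?L w = \<sigma>}" .
    qed auto
    finally show ?thesis by (simp add: v_def)
  qed
  hence "(\<Sum>\<sigma>\<in>?S. 2 * p * (?c n \<sigma> * \<delta> ^ (card (\<sigma> ` {..?L}) - 1))) \<le> (\<Sum>\<sigma>\<in>?S. n * ?c ?L \<sigma>)"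
    by (rule sum_mono)
  also have "\<dots> = n * real (card {w. w \<in> walks ?L ?L \<and> repeating ?L w})"
    using sum_repeating_walks[of "\<lambda>_. 1" ?L ?L] by (simp add: sum_distrib_left)
  finally show ?thesis
    unfolding sum_repeating_walks[where g = "\<lambda>v. \<delta> ^ (v - 1)"] unfolding sum_distrib_left .
qed

section \<open>Traces of random symmetric matrices\<close>

definition edges :: "nat \<Rightarrow> (nat \<times> nat) set" where
  "edges n = {(i, j). i < j \<and> j < n}"

definition entry_mat :: "(nat \<times> nat \<Rightarrow> real) \<Rightarrow> nat \<Rightarrow> nat \<Rightarrow> real" where
  "entry_mat x i j = (if i = j then 0 else x (edge i j))"

definition step_count :: "nat \<Rightarrow> (nat \<Rightarrow> nat) \<Rightarrow> nat \<times> nat \<Rightarrow> nat" where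
  "step_count L w e = card {t \<in> {..<L}. step w t = e}"

lemma finite_edges: "finite (edges n)"
  by (rule finite_subset[of _ "{..<n} \<times> {..<n}"]) (auto simp: edges_def)

lemma sym_entry_mat: "sym_mat n (entry_mat x)"
  by (auto simp: sym_mat_def entry_mat_def edge_def min.commute max.commute)

lemma edge_in_edges: "i < n \<Longrightarrow> j < n \<Longrightarrow> i \<noteq> j \<Longrightarrow> edge i j \<in> edges n"
  by (auto simp: edge_def edges_def min_def max_def)

lemma step_in_edges:
  assumes "w \<in> walks n L" "loopfree_closed L w" "t < L"
  shows "step w t \<in> edges n"
  using assms by (intro edge_in_edges) (auto simp: walks_def loopfree_closed_def PiE_iff)

text \<open>Collecting equal edges writes the weight as a product of functions of independent
  entries.\<close>

lemma prod_entry_mat_walk: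
  assumes "w \<in> walks n L" "loopfree_closed L w"
  shows "(\<Prod>t<L. entry_mat x (w t) (w (Suc t))) = (\<Prod>e\<in>edges n. x e ^ step_count L w e)"
proof -
  have "(\<Prod>t<L. entry_mat x (w t) (w (Suc t))) = (\<Prod>t<L. x (step w t))"
    using assms by (intro prod.cong) (auto simp: entry_mat_def loopfree_closed_def)
  also have "\<dots> = (\<Prod>e\<in>edges n. \<Prod>t\<in>{t \<in> {..<L}. step w t = e}. x (step w t))"
    using step_in_edges[OF assms] finite_edges by (intro prod.group[symmetric]) auto
  also have "\<dots> = (\<Prod>e\<in>edges n. x e ^ step_count L w e)"
    by (intro prod.cong refl) (simp add: step_count_def)
  finally show ?thesis .
qed

lemma mat_trace_entry_mat_pow:
  "mat_trace n (mat_pow n (entry_mat x) L)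
    = (\<Sum>w | w \<in> walks n L \<and> loopfree_closed L w. \<Prod>e\<in>edges n. x e ^ step_count L w e)"
proof -
  let ?f = "\<lambda>w. of_bool (w L = w 0) * (\<Prod>t<L. entry_mat x (w t) (w (Suc t)))"
  \<comment> \<open>A closed walk that stays in place at some step meets the zero diagonal.\<close>
  have "?f w = 0" if "\<not> loopfree_closed L w" for w
  proof (cases "w L = w 0")
    case True
    with that obtain t where "t < L" "w t = w (Suc t)" by (auto simp: loopfree_closed_def)
    hence "(\<Prod>t<L. entry_mat x (w t) (w (Suc t))) = 0"
      by (intro prod_zero) (auto simp: entry_mat_def)
    thus ?thesis by simp
  qed simp
  hence "(\<Sum>w\<in>walks n L. ?f w) = (\<Sum>w | w \<in> walks n L \<and> loopfree_closed L w. ?f w)"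
    using finite_walks by (intro sum.mono_neutral_right) auto
  also have "\<dots> = (\<Sum>w | w \<in> walks n L \<and> loopfree_closed L w. \<Prod>e\<in>edges n. x e ^ step_count L w e)"
    by (intro sum.cong refl) (auto simp: prod_entry_mat_walk loopfree_closed_def[THEN iffD1])
  finally show ?thesis by (simp add: mat_trace_mat_pow)
qed

lemma step_count_eq_0: "e \<notin> step w ` {..<L} \<Longrightarrow> step_count L w e = 0"
  by (auto simp: step_count_def)

lemma step_count_repeating:
  assumes "repeating L w" "e \<in> step w ` {..<L}"
  shows "2 \<le> step_count L w e"
proof -
  obtain t where t: "t < L" "e = step w t" using assms(2) by auto
  then obtain s where "s < L" "s \<noteq> t" "step w s = step w t"
    using assms(1) by (auto simp: repeating_def)
  with t have "card {s, t} \<le> step_count L w e"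
    unfolding step_count_def by (intro card_mono) auto
  with \<open>s \<noteq> t\<close> show ?thesis by simp
qed

lemma step_count_not_repeating:
  assumes "w \<in> walks n L" "loopfree_closed L w" "\<not> repeating L w"
  obtains e where "e \<in> edges n" "step_count L w e = 1"
proof -
  obtain t where t: "t < L" "\<And>s. s < L \<Longrightarrow> s \<noteq> t \<Longrightarrow> step w s \<noteq> step w t"
    using assms(2,3) by (auto simp: repeating_def)
  hence "{s \<in> {..<L}. step w s = step w t} = {t}" by auto
  thus ?thesis
    using t step_in_edges[OF assms(1,2)] by (intro that[of "step w t"]) (auto simp: step_count_def)
qed

text \<open>Shared by the centred adjacency matrix and the comparison matrix. Finite support makes
  every real function integrable.\<close>

locale independent_entries =
  fixes M :: "'a pmf" and n :: nat and X :: "nat \<times> nat \<Rightarrow> 'a \<Rightarrow> real"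
  assumes finite_support: "finite (set_pmf M)"
    and indep: "prob_space.indep_vars (measure_pmf M) (\<lambda>_. borel) X (edges n)"
begin

lemma integrable [simp]: "integrable (measure_pmf M) f" for f :: "'a \<Rightarrow> real"
  by (rule integrable_measure_pmf_finite[OF finite_support])

lemma expectation_prod:
  assumes "\<And>e. e \<in> edges n \<Longrightarrow> f e \<in> borel_measurable borel"
  shows "measure_pmf.expectation M (\<lambda>\<omega>. \<Prod>e\<in>edges n. f e (X e \<omega>))
    = (\<Prod>e\<in>edges n. measure_pmf.expectation M (\<lambda>\<omega>. f e (X e \<omega>) :: real))"
  using assms finite_edges
  by (intro prob_space.indep_vars_lebesgue_integral prob_space.indep_vars_compose2[OF _ indep]
      measure_pmf.prob_space_axioms) auto

text \<open>Independence factorises each walk's expectation. A walk that is not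
  \<open>repeating\<close> uses some edge exactly once, and that factor is a mean, hence 0.\<close>

lemma expectation_mat_trace_pow:
  assumes "\<And>e. e \<in> edges n \<Longrightarrow> measure_pmf.expectation M (X e) = 0"
  shows "measure_pmf.expectation M (\<lambda>\<omega>. mat_trace n (mat_pow n (entry_mat (\<lambda>e. X e \<omega>)) L))
    = (\<Sum>w | w \<in> walks n L \<and> repeating L w.
        \<Prod>e\<in>step w ` {..<L}. measure_pmf.expectation M (\<lambda>\<omega>. X e \<omega> ^ step_count L w e))"
proof -
  let ?m = "\<lambda>w e. measure_pmf.expectation M (\<lambda>\<omega>. X e \<omega> ^ step_count L w e)"
  have "measure_pmf.expectation M (\<lambda>\<omega>. mat_trace n (mat_pow n (entry_mat (\<lambda>e. X e \<omega>)) L))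
    = (\<Sum>w | w \<in> walks n L \<and> loopfree_closed L w. \<Prod>e\<in>edges n. ?m w e)"
    unfolding mat_trace_entry_mat_pow
    by (subst Bochner_Integration.integral_sum) (auto intro!: sum.cong expectation_prod)
  also have "\<dots> = (\<Sum>w | w \<in> walks n L \<and> repeating L w. \<Prod>e\<in>edges n. ?m w e)"
  proof (intro sum.mono_neutral_right ballI)
    fix w assume w: "w \<in> {w. w \<in> walks n L \<and> loopfree_closed L w} - {w. w \<in> walks n L \<and> repeating L w}"
    then obtain e where "e \<in> edges n" "step_count L w e = 1"
      using step_count_not_repeating[of w n L] by blast
    with assms[of e] have "?m w e = 0" by simp
    with \<open>e \<in> edges n\<close> show "(\<Prod>e\<in>edges n. ?m w e) = 0"
      using finite_edges by (intro prod_zero) auto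
  qed (use finite_walks[of n L] in \<open>auto simp: repeating_def\<close>)
  also have "\<dots> = (\<Sum>w | w \<in> walks n L \<and> repeating L w. \<Prod>e\<in>step w ` {..<L}. ?m w e)"
  proof (intro sum.cong refl prod.mono_neutral_right ballI)
    fix w assume "w \<in> {w. w \<in> walks n L \<and> repeating L w}"
    thus "step w ` {..<L} \<subseteq> edges n"
      using step_in_edges[of w n L] by (auto simp: repeating_def)
  qed (use finite_edges in \<open>auto simp: step_count_eq_0\<close>)
  finally show ?thesis .
qed

text \<open>Each distinct edge of the walk contributes at most \<open>\<delta>\<close>. There are at
  least as many edges as nodes minus one, and \<open>\<delta> \<le> 1\<close> allows lowering the
  exponent.\<close>

lemma expectation_mat_trace_pow_le:
  assumes mean: "\<And>e. e \<in> edges n \<Longrightarrow> measure_pmf.expectation M (X e) = 0"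
    and moment: "\<And>e k. e \<in> edges n \<Longrightarrow> 2 \<le> k \<Longrightarrow> \<bar>measure_pmf.expectation M (\<lambda>\<omega>. X e \<omega> ^ k)\<bar> \<le> \<delta>"
    and \<delta>: "0 \<le> \<delta>" "\<delta> \<le> 1"
  shows "measure_pmf.expectation M (\<lambda>\<omega>. mat_trace n (mat_pow n (entry_mat (\<lambda>e. X e \<omega>)) L))
    \<le> (\<Sum>w | w \<in> walks n L \<and> repeating L w. \<delta> ^ (card (w ` {..L}) - 1))"
proof (subst expectation_mat_trace_pow[OF mean], assumption, intro sum_mono)
  fix w assume "w \<in> {w. w \<in> walks n L \<and> repeating L w}"
  hence w: "w \<in> walks n L" "repeating L w" "loopfree_closed L w" by (auto simp: repeating_def)
  let ?m = "\<lambda>e. measure_pmf.expectation M (\<lambda>\<omega>. X e \<omega> ^ step_count L w e)"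
  have "(\<Prod>e\<in>step w ` {..<L}. ?m e) \<le> \<bar>\<Prod>e\<in>step w ` {..<L}. ?m e\<bar>" by simp
  also have "\<dots> = (\<Prod>e\<in>step w ` {..<L}. \<bar>?m e\<bar>)" by (rule abs_prod)
  also have "\<dots> \<le> (\<Prod>e\<in>step w ` {..<L}. \<delta>)"
  proof (intro prod_mono conjI)
    fix e assume e: "e \<in> step w ` {..<L}"
    hence "e \<in> edges n" using step_in_edges[OF w(1,3)] by auto
    thus "\<bar>?m e\<bar> \<le> \<delta>" using moment step_count_repeating[OF w(2) e] by blast
  qed auto
  also have "\<dots> = \<delta> ^ card (step w ` {..<L})" by simp
  also have "\<dots> \<le> \<delta> ^ (card (w ` {..L}) - 1)"
    using card_vertices_le_card_steps[of w L] \<delta> by (intro power_decreasing) auto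
  finally show "(\<Prod>e\<in>step w ` {..<L}. ?m e) \<le> \<delta> ^ (card (w ` {..L}) - 1)" .
qed

text \<open>The reverse direction, for the comparison matrix: moments of at least 1 make every
  repeating walk contribute at least 1.\<close>

lemma expectation_mat_trace_pow_ge:
  assumes mean: "\<And>e. e \<in> edges n \<Longrightarrow> measure_pmf.expectation M (X e) = 0"
    and moment: "\<And>e k. e \<in> edges n \<Longrightarrow> 2 \<le> k \<Longrightarrow> 1 \<le> measure_pmf.expectation M (\<lambda>\<omega>. X e \<omega> ^ k)"
  shows "card {w. w \<in> walks n L \<and> repeating L w}
    \<le> measure_pmf.expectation M (\<lambda>\<omega>. mat_trace n (mat_pow n (entry_mat (\<lambda>e. X e \<omega>)) L))"
proof -
  have "(\<Sum>w | w \<in> walks n L \<and> repeating L w. 1)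
    \<le> measure_pmf.expectation M (\<lambda>\<omega>. mat_trace n (mat_pow n (entry_mat (\<lambda>e. X e \<omega>)) L))"
  proof (subst expectation_mat_trace_pow[OF mean], assumption, intro sum_mono prod_ge_1)
    fix w e assume "w \<in> {w. w \<in> walks n L \<and> repeating L w}" and e: "e \<in> step w ` {..<L}"
    hence w: "w \<in> walks n L" "repeating L w" "loopfree_closed L w" by (auto simp: repeating_def)
    from e have "e \<in> edges n" using step_in_edges[OF w(1,3)] by auto
    thus "1 \<le> measure_pmf.expectation M (\<lambda>\<omega>. X e \<omega> ^ step_count L w e)"
      using moment step_count_repeating[OF w(2) e] by blast
  qed
  thus ?thesis by simp
qed

end

section \<open>Comparison with a two-point matrix\<close>

text \<open>
  The values 2 and -1 give mean 0 and all higher moments at least 1. A symmetric distribution would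
  not do, because closed walks may use an edge an odd number of times.
\<close>
definition two_point :: "real pmf" where
  "two_point = map_pmf (\<lambda>b. if b then 2 else - 1) (bernoulli_pmf (1/3))"

lemma expectation_two_point:
  "measure_pmf.expectation two_point f = f 2 / 3 + 2 * f (- 1) / 3" for f :: "real \<Rightarrow> real"
  unfolding two_point_def integral_map_pmf by (subst integral_bernoulli_pmf) auto

lemma set_two_point: "set_pmf two_point = {2, - 1}"
  by (auto simp: two_point_def)

lemma two_point_moment_ge:
  assumes "2 \<le> k"
  shows "1 \<le> measure_pmf.expectation two_point (\<lambda>y. y ^ k)"
proof -
  have bound: "(3::real) \<le> 2 ^ k + 2 * (- 1) ^ k"
  proof (cases "even k")
    case True
    have "(2::real) ^ 0 \<le> 2 ^ k" by (intro power_increasing) auto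
    with True show ?thesis by simp
  next
    case False
    \<comment> \<open>The negative value now subtracts 2, and \<open>2 ^ 3 - 2\<close> still exceeds
      3.\<close>
    with assms have "3 \<le> k" by (cases "k = 2") auto
    hence "(2::real) ^ 3 \<le> 2 ^ k" by (intro power_increasing) auto
    with False show ?thesis by simp
  qed
  thus ?thesis by (simp add: expectation_two_point)
qed

text \<open>Hoeffding's lemma for a centred variable in an interval of length
  \<open>3 * \<bar>s\<bar>\<close>; the minimum and maximum order its ends for either sign of
  \<open>s\<close>.\<close>

lemma two_point_mgf_le: "measure_pmf.expectation two_point (\<lambda>y. exp (s * y)) \<le> exp (9 / 8 * s\<^sup>2)"
proof -
  let ?a = "min (2 * s) (- s)" and ?b = "max (2 * s) (- s)"
  interpret interval_bounded_random_variable "measure_pmf two_point" "\<lambda>y. s * y" ?a ?b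
    by unfold_locales (auto simp: AE_measure_pmf_iff set_two_point)
  have "ennreal (measure_pmf.expectation two_point (\<lambda>y. exp (s * y)))
      = (\<integral>\<^sup>+ y. exp (1 * (s * y)) \<partial>measure_pmf two_point)"
    by (subst nn_integral_eq_integral)
      (auto intro!: integrable_measure_pmf_finite simp: set_two_point)
  also have "\<dots> \<le> ennreal (exp (1\<^sup>2 * (?b - ?a)\<^sup>2 / 8))"
    by (rule Hoeffdings_lemma_nn_integral_0) (simp_all add: expectation_two_point)
  also have "1\<^sup>2 * (?b - ?a)\<^sup>2 / 8 = 9 / 8 * s\<^sup>2"
    by (simp add: min_def max_def power2_eq_square)
  finally show ?thesis by (simp add: ennreal_le_iff)
qed

definition two_point_entries :: "nat \<Rightarrow> (nat \<times> nat \<Rightarrow> real) pmf" where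
  "two_point_entries n = Pi_pmf (edges n) 0 (\<lambda>_. two_point)"

lemma independent_two_point_entries:
  "independent_entries (two_point_entries n) n (\<lambda>e y. y e)"
proof
  show "finite (set_pmf (two_point_entries n))"
    unfolding two_point_entries_def set_Pi_pmf[OF finite_edges]
    by (intro finite_PiE_dflt finite_edges) (simp add: set_two_point)
  have "prob_space.indep_vars (two_point_entries n) (\<lambda>_. count_space UNIV) (\<lambda>e y. y e) (edges n)"
    unfolding two_point_entries_def by (rule indep_vars_Pi_pmf[OF finite_edges])
  thus "prob_space.indep_vars (two_point_entries n) (\<lambda>_. borel) (\<lambda>e y. y e) (edges n)"
    by (rule prob_space.indep_vars_compose2[OF measure_pmf.prob_space_axioms, where Y = "\<lambda>_ y. y"]) simp
qed

lemma expectation_two_point_entry: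
  fixes f :: "real \<Rightarrow> real"
  assumes "e \<in> edges n"
  shows "measure_pmf.expectation (two_point_entries n) (\<lambda>y. f (y e)) = measure_pmf.expectation two_point f"
proof -
  have "measure_pmf.expectation (two_point_entries n) (\<lambda>y. f (y e))
      = measure_pmf.expectation (map_pmf (\<lambda>y. y e) (two_point_entries n)) f"
    by (simp add: integral_map_pmf)
  also have "map_pmf (\<lambda>y. y e) (two_point_entries n) = two_point"
    unfolding two_point_entries_def using assms by (simp add: Pi_pmf_component finite_edges)
  finally show ?thesis .
qed

lemma edges_Suc: "edges (Suc n) = edges n \<union> (\<lambda>i. (i, n)) ` {..<n}"
  by (auto simp: edges_def)

lemma sum_square_eq_sum_edges:
  fixes f :: "nat \<Rightarrow> nat \<Rightarrow> real"
  shows "(\<Sum>i<n. \<Sum>j<n. f i j) = (\<Sum>(i, j)\<in>edges n. f i j + f j i) + (\<Sum>i<n. f i i)"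
proof (induction n)
  case 0
  show ?case by (simp add: edges_def)
next
  case (Suc n)
  have "(\<Sum>(i, j)\<in>edges (Suc n). f i j + f j i)
      = (\<Sum>(i, j)\<in>edges n. f i j + f j i) + (\<Sum>(i, j)\<in>(\<lambda>i. (i, n)) ` {..<n}. f i j + f j i)"
    unfolding edges_Suc by (intro sum.union_disjoint finite_edges) (auto simp: edges_def)
  also have "(\<Sum>(i, j)\<in>(\<lambda>i. (i, n)) ` {..<n}. f i j + f j i) = (\<Sum>i<n. f i n + f n i)"
    by (subst sum.reindex) (auto simp: inj_on_def)
  finally show ?case using Suc by (simp add: sum.distrib)
qed

section \<open>Moments of bilinear forms in the two-point matrix\<close>

text \<open>Both positions of an edge are merged, so that the form becomes a linear combination of
  independent entries.\<close>

lemma dot_entry_mat: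
  "dot n y (mat_app n (entry_mat x) z) = (\<Sum>(i, j)\<in>edges n. (y i * z j + y j * z i) * x (i, j))"
proof -
  have "dot n y (mat_app n (entry_mat x) z) = (\<Sum>i<n. \<Sum>j<n. y i * z j * entry_mat x i j)"
    by (simp add: dot_def mat_app_def sum_distrib_left mult_ac)
  also have "\<dots> = (\<Sum>(i, j)\<in>edges n. (y i * z j + y j * z i) * x (i, j))"
    unfolding sum_square_eq_sum_edges
    by (simp add: entry_mat_def) (auto intro!: sum.cong simp: edges_def edge_def min_def max_def algebra_simps)
  finally show ?thesis .
qed

lemma sum_edges_square_le:
  fixes y z :: "nat \<Rightarrow> real"
  shows "(\<Sum>(i, j)\<in>edges n. (y i * z j + y j * z i)\<^sup>2) \<le> 2 * dot n y y * dot n z z"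
proof -
  have "(\<Sum>(i, j)\<in>edges n. (y i * z j + y j * z i)\<^sup>2)
      \<le> (\<Sum>(i, j)\<in>edges n. 2 * ((y i)\<^sup>2 * (z j)\<^sup>2) + 2 * ((y j)\<^sup>2 * (z i)\<^sup>2))"
  proof (intro sum_mono, clarify)
    fix i j
    have "0 \<le> (y i * z j - y j * z i)\<^sup>2" by simp
    thus "(y i * z j + y j * z i)\<^sup>2 \<le> 2 * ((y i)\<^sup>2 * (z j)\<^sup>2) + 2 * ((y j)\<^sup>2 * (z i)\<^sup>2)"
      by (simp add: power2_eq_square algebra_simps)
  qed
  \<comment> \<open>Adding the nonnegative diagonal completes the sum to all pairs, where it
    factorises.\<close>
  also have "\<dots> \<le> (\<Sum>(i, j)\<in>edges n. 2 * ((y i)\<^sup>2 * (z j)\<^sup>2) + 2 * ((y j)\<^sup>2 * (z i)\<^sup>2))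
      + (\<Sum>i<n. 2 * ((y i)\<^sup>2 * (z i)\<^sup>2))"
    by (simp add: sum_nonneg)
  also have "\<dots> = (\<Sum>i<n. \<Sum>j<n. 2 * ((y i)\<^sup>2 * (z j)\<^sup>2))"
    by (rule sum_square_eq_sum_edges[symmetric])
  also have "\<dots> = 2 * dot n y y * dot n z z"
    by (simp add: dot_def power2_eq_square sum_product sum_distrib_left mult_ac)
  finally show ?thesis .
qed

lemma two_point_dot_mgf_le:
  "measure_pmf.expectation (two_point_entries n) (\<lambda>x. exp (s * dot n y (mat_app n (entry_mat x) z)))
    \<le> exp (9 / 4 * s\<^sup>2 * dot n y y * dot n z z)"
proof -
  interpret independent_entries "two_point_entries n" n "\<lambda>e y. y e"
    by (rule independent_two_point_entries)
  define c where "c = (\<lambda>(i, j). y i * z j + y j * z i)"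
  have "measure_pmf.expectation (two_point_entries n) (\<lambda>x. exp (s * dot n y (mat_app n (entry_mat x) z)))
      = measure_pmf.expectation (two_point_entries n) (\<lambda>x. \<Prod>e\<in>edges n. exp (s * c e * x e))"
    unfolding dot_entry_mat c_def
    by (simp add: exp_sum[OF finite_edges, symmetric] sum_distrib_left case_prod_unfold mult.assoc)
  also have "\<dots> = (\<Prod>e\<in>edges n. measure_pmf.expectation (two_point_entries n) (\<lambda>x. exp (s * c e * x e)))"
    by (rule expectation_prod) simp
  also have "\<dots> \<le> (\<Prod>e\<in>edges n. exp (9 / 8 * (s * c e)\<^sup>2))"
  proof (intro prod_mono conjI)
    fix e assume "e \<in> edges n"
    thus "measure_pmf.expectation (two_point_entries n) (\<lambda>x. exp (s * c e * x e)) \<le> exp (9 / 8 * (s * c e)\<^sup>2)"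
      by (subst expectation_two_point_entry[of e n "\<lambda>x. exp (s * c e * x)"]) (simp_all only: two_point_mgf_le)
  qed (simp add: Bochner_Integration.integral_nonneg)
  also have "\<dots> = exp (9 / 8 * s\<^sup>2 * (\<Sum>e\<in>edges n. (c e)\<^sup>2))"
    by (simp add: exp_sum[OF finite_edges, symmetric] sum_distrib_left power_mult_distrib mult.assoc)
  also have "(\<Sum>e\<in>edges n. (c e)\<^sup>2) = (\<Sum>(i, j)\<in>edges n. (y i * z j + y j * z i)\<^sup>2)"
    by (simp add: c_def case_prod_unfold)
  also have "exp (9 / 8 * s\<^sup>2 * (\<Sum>(i, j)\<in>edges n. (y i * z j + y j * z i)\<^sup>2))
      \<le> exp (9 / 8 * s\<^sup>2 * (2 * dot n y y * dot n z z))"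
    unfolding exp_le_cancel_iff by (intro mult_left_mono sum_edges_square_le) simp
  finally show ?thesis by (simp add: mult_ac)
qed

text \<open>A single term of the exponential series at \<open>\<bar>x\<bar>\<close> is at most the
  whole series; the even exponent removes the sign.\<close>

lemma power_le_fact_mult_exp:
  fixes x :: real
  shows "x ^ (2 * p) \<le> fact (2 * p) * (exp x + exp (- x))"
proof -
  have "\<bar>x\<bar> ^ (2 * p) / fact (2 * p) = (\<Sum>k\<in>{2 * p}. \<bar>x\<bar> ^ k /\<^sub>R fact k)"
    by (simp add: divide_inverse mult.commute)
  also have "\<dots> \<le> exp \<bar>x\<bar>"
    unfolding exp_def by (intro sum_le_suminf summable_exp_generic) auto
  also have "\<dots> \<le> exp x + exp (- x)" by (simp add: abs_if)
  finally show ?thesis by (simp add: divide_le_eq mult.commute power_even_abs)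
qed

lemma two_point_dot_moment_le:
  assumes "y \<in> lattice_net n" "z \<in> lattice_net n" "n = 2 * p" "0 < p"
  shows "measure_pmf.expectation (two_point_entries n)
      (\<lambda>x. dot n (\<lambda>i. real_of_int (y i)) (mat_app n (entry_mat x) (\<lambda>i. real_of_int (z i))) ^ (2 * p))
    \<le> 2 * real n ^ n * (36 * real n * (exp 1)\<^sup>2) ^ p"
proof -
  interpret independent_entries "two_point_entries n" n "\<lambda>e y. y e"
    by (rule independent_two_point_entries)
  let ?E = "measure_pmf.expectation (two_point_entries n)"
  define Z where "Z x = dot n (\<lambda>i. real_of_int (y i)) (mat_app n (entry_mat x) (\<lambda>i. real_of_int (z i)))" for x
  \<comment> \<open>With squared norms at most \<open>4 * n\<close>, this choice makes the exponent
    \<open>9 / 4 * s\<^sup>2 * (4 * n)\<^sup>2\<close> equal to \<open>n\<close>.\<close>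
  define s where "s = 1 / (6 * sqrt n)"
  have n: "0 < n" using assms by simp
  have s: "0 < s" "s\<^sup>2 = 1 / (36 * n)" using n by (auto simp: s_def power_divide power_mult_distrib)
  \<comment> \<open>Stated for \<open>u\<close> so that it covers both \<open>s\<close> and
    \<open>- s\<close>.\<close>
  have mgf: "?E (\<lambda>x. exp (u * Z x)) \<le> exp n" if u: "u\<^sup>2 = s\<^sup>2" for u
  proof -
    let ?y = "\<lambda>i. real_of_int (y i)" and ?z = "\<lambda>i. real_of_int (z i)"
    have yz: "dot n ?y ?y \<le> 4 * real n" "dot n ?z ?z \<le> 4 * real n"
      using assms(1,2) by (auto simp: lattice_net_def dot_def power2_eq_square)
    have "dot n ?y ?y * dot n ?z ?z \<le> (4 * real n) * (4 * real n)"
      using yz by (intro mult_mono) (auto simp: dot_def sum_nonneg)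
    hence "9 / 4 * s\<^sup>2 * (dot n ?y ?y * dot n ?z ?z) \<le> 9 / 4 * s\<^sup>2 * ((4 * real n) * (4 * real n))"
      by (intro mult_left_mono) auto
    also have "\<dots> = n" using n by (simp add: s field_simps)
    finally have "9 / 4 * u\<^sup>2 * dot n ?y ?y * dot n ?z ?z \<le> n"
      unfolding u by (simp only: mult.assoc)
    hence "exp (9 / 4 * u\<^sup>2 * dot n ?y ?y * dot n ?z ?z) \<le> exp n"
      by (simp only: exp_le_cancel_iff)
    with two_point_dot_mgf_le[of n u ?y ?z] show ?thesis unfolding Z_def by (rule order_trans)
  qed
  have "s ^ (2 * p) * ?E (\<lambda>x. Z x ^ (2 * p)) = ?E (\<lambda>x. (s * Z x) ^ (2 * p))"
    by (simp add: power_mult_distrib)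
  also have "\<dots> \<le> ?E (\<lambda>x. fact (2 * p) * (exp (s * Z x) + exp (- (s * Z x))))"
    by (intro integral_mono power_le_fact_mult_exp) auto
  also have "\<dots> = fact n * (?E (\<lambda>x. exp (s * Z x)) + ?E (\<lambda>x. exp ((- s) * Z x)))"
    by (simp add: assms(3)[symmetric])
  also have "\<dots> \<le> real n ^ n * (exp n + exp n)"
  proof (intro mult_mono add_mono mgf)
    show "fact n \<le> real n ^ n" using fact_le_power[of n, where ?'a = real] by simp
  qed auto
  also have "exp (real n) = ((exp 1)\<^sup>2) ^ p"
    using exp_of_nat_mult[of n "1::real"] assms(3) by (simp add: power_mult)
  finally have "(s\<^sup>2) ^ p * ?E (\<lambda>x. Z x ^ (2 * p)) \<le> 2 * real n ^ n * ((exp 1)\<^sup>2) ^ p"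
    by (simp add: power_mult)
  hence "(36 * real n) ^ p * ((s\<^sup>2) ^ p * ?E (\<lambda>x. Z x ^ (2 * p)))
      \<le> (36 * real n) ^ p * (2 * real n ^ n * ((exp 1)\<^sup>2) ^ p)"
    by (intro mult_left_mono) auto
  also have "(36 * real n) ^ p * ((s\<^sup>2) ^ p * ?E (\<lambda>x. Z x ^ (2 * p)))
      = (36 * real n * s\<^sup>2) ^ p * ?E (\<lambda>x. Z x ^ (2 * p))"
    by (simp add: power_mult_distrib mult_ac)
  also have "36 * real n * s\<^sup>2 = 1" using n by (simp add: s)
  also have "(36 * real n) ^ p * (2 * real n ^ n * ((exp 1)\<^sup>2) ^ p)
      = 2 * real n ^ n * (36 * real n * (exp 1)\<^sup>2) ^ p"
    by (simp add: power_mult_distrib mult_ac)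
  finally show ?thesis by (simp add: Z_def)
qed

text \<open>The largest value on the net bounds the operator norm. Its even power is at most the sum
  of all even powers, whose expectation can be taken term by term.\<close>

lemma mat_trace_even_pow_le_net:
  assumes "sym_mat n M" "0 < n"
  shows "mat_trace n (mat_pow n M (2 * p)) \<le> n / real n ^ (2 * p) *
    (\<Sum>y\<in>lattice_net n. \<Sum>z\<in>lattice_net n.
      dot n (\<lambda>i. real_of_int (y i)) (mat_app n M (\<lambda>i. real_of_int (z i))) ^ (2 * p))"
proof -
  define D where "D = (\<lambda>(y, z). dot n (\<lambda>i. real_of_int (y i)) (mat_app n M (\<lambda>i. real_of_int (z i))))"
  let ?T = "lattice_net n \<times> lattice_net n"
  define B where "B = Max (D ` ?T)"
  have fin: "finite (D ` ?T)" using finite_lattice_net by auto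
  have zero: "((\<lambda>i\<in>{..<n}. 0), (\<lambda>i\<in>{..<n}. 0)) \<in> ?T" using zero_in_lattice_net by auto
  have D_le: "D yz \<le> B" if "yz \<in> ?T" for yz unfolding B_def using fin that by (intro Max_ge) auto
  have "D ((\<lambda>i\<in>{..<n}. 0), (\<lambda>i\<in>{..<n}. 0)) = 0" by (simp add: D_def dot_def)
  hence B0: "0 \<le> B" using D_le[OF zero] by simp
  have "B \<in> D ` ?T" unfolding B_def using fin zero by (intro Max_in) auto
  then obtain yz where yz: "yz \<in> ?T" "B = D yz" by auto
  have "mat_trace n (mat_pow n M (2 * p)) \<le> n * (B / n) ^ (2 * p)"
  proof (rule mat_trace_even_pow_le[OF assms(1)])
    fix x show "nrm n (mat_app n M x) \<le> B / n * nrm n x"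
    proof (rule nrm_mat_app_le_lattice_net[OF assms(2)])
      fix y z assume "y \<in> lattice_net n" "z \<in> lattice_net n"
      with D_le[of "(y, z)"]
      show "dot n (\<lambda>i. real_of_int (y i)) (mat_app n M (\<lambda>i. real_of_int (z i))) \<le> B"
        by (simp add: D_def)
    qed
  qed (use B0 in simp)
  also have "\<dots> = n / real n ^ (2 * p) * D yz ^ (2 * p)" by (simp add: yz power_divide)
  also have "\<dots> \<le> n / real n ^ (2 * p) * (\<Sum>yz\<in>?T. D yz ^ (2 * p))"
    using yz finite_lattice_net by (intro mult_left_mono member_le_sum) auto
  also have "(\<Sum>yz\<in>?T. D yz ^ (2 * p)) = (\<Sum>y\<in>lattice_net n. \<Sum>z\<in>lattice_net n.
      dot n (\<lambda>i. real_of_int (y i)) (mat_app n M (\<lambda>i. real_of_int (z i))) ^ (2 * p))"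
    by (simp add: D_def sum.cartesian_product case_prod_unfold)
  finally show ?thesis .
qed

text \<open>The first factor comes from the number of pairs of net points, a square of an
  \<open>n\<close>-th power with \<open>n = 2 * p\<close>; the second from the moment of one
  bilinear form.\<close>

definition trace_const :: real where "trace_const = (3 * exp 4) ^ 4 * (36 * (exp 1)\<^sup>2)"

lemma trace_const_pos: "0 < trace_const"
  by (simp add: trace_const_def)

lemma expectation_two_point_trace_le:
  assumes "n = 2 * p" "0 < p"
  shows "measure_pmf.expectation (two_point_entries n) (\<lambda>x. mat_trace n (mat_pow n (entry_mat x) (2 * p)))
    \<le> 2 * n * (trace_const * n) ^ p"
proof -
  interpret independent_entries "two_point_entries n" n "\<lambda>e y. y e"
    by (rule independent_two_point_entries)
  let ?E = "measure_pmf.expectation (two_point_entries n)"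
  let ?T = "lattice_net n"
  let ?D = "\<lambda>x y z. dot n (\<lambda>i. real_of_int (y i)) (mat_app n (entry_mat x) (\<lambda>i. real_of_int (z i))) ^ (2 * p)"
  let ?b = "2 * real n ^ n * (36 * real n * (exp 1)\<^sup>2) ^ p"
  have n: "0 < n" using assms by simp
  have "?E (\<lambda>x. mat_trace n (mat_pow n (entry_mat x) (2 * p)))
      \<le> ?E (\<lambda>x. n / real n ^ (2 * p) * (\<Sum>y\<in>?T. \<Sum>z\<in>?T. ?D x y z))"
    using n by (intro integral_mono mat_trace_even_pow_le_net sym_entry_mat) auto
  also have "\<dots> = n / real n ^ (2 * p) * (\<Sum>y\<in>?T. \<Sum>z\<in>?T. ?E (\<lambda>x. ?D x y z))"
    by (simp add: Bochner_Integration.integral_sum)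
  also have "\<dots> \<le> n / real n ^ (2 * p) * (\<Sum>y\<in>?T. \<Sum>z\<in>?T. ?b)"
    using assms by (intro mult_left_mono sum_mono two_point_dot_moment_le) auto
  \<comment> \<open>Since \<open>n = 2 * p\<close>, the powers \<open>n ^ n\<close> and
    \<open>n ^ (2 * p)\<close> cancel.\<close>
  also have "\<dots> = 2 * n * (36 * real n * (exp 1)\<^sup>2) ^ p * (real (card ?T))\<^sup>2"
    using n assms(1) by (simp add: power2_eq_square)
  also have "\<dots> \<le> 2 * n * (36 * real n * (exp 1)\<^sup>2) ^ p * ((3 * exp 4) ^ n)\<^sup>2"
    by (intro mult_left_mono power_mono card_lattice_net) auto
  also have "((3 * exp 4) ^ n)\<^sup>2 = ((3 * exp 4 :: real) ^ 4) ^ p"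
    unfolding assms(1) power_mult[symmetric] by (rule arg_cong[of _ _ "power _"]) simp
  also have "2 * n * (36 * real n * (exp 1)\<^sup>2) ^ p * ((3 * exp 4 :: real) ^ 4) ^ p
      = 2 * n * (36 * real n * (exp 1)\<^sup>2 * (3 * exp 4) ^ 4) ^ p"
    by (simp only: power_mult_distrib mult.assoc)
  also have "36 * real n * (exp 1)\<^sup>2 * (3 * exp 4) ^ 4 = trace_const * n" by (simp add: trace_const_def)
  finally show ?thesis by simp
qed

text \<open>Chains four estimates: trace by weighted walks, these by walks in \<open>2 * p\<close>
  nodes, their number by the two-point trace, and that trace by the net. The factor
  \<open>2 * p\<close> then cancels.\<close>

lemma (in independent_entries) expectation_trace_comparison:
  fixes \<delta> :: real and p :: nat
  assumes mean: "\<And>e. e \<in> edges n \<Longrightarrow> measure_pmf.expectation M (X e) = 0"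
    and moment: "\<And>e k. e \<in> edges n \<Longrightarrow> 2 \<le> k \<Longrightarrow> \<bar>measure_pmf.expectation M (\<lambda>\<omega>. X e \<omega> ^ k)\<bar> \<le> \<delta>"
    and \<delta>: "0 \<le> \<delta>" "\<delta> \<le> 1" "n * \<delta> \<le> p" and p: "0 < p"
  shows "measure_pmf.expectation M (\<lambda>\<omega>. mat_trace n (mat_pow n (entry_mat (\<lambda>e. X e \<omega>)) (2 * p)))
    \<le> 2 * n * (2 * trace_const * p) ^ p"
proof -
  let ?L = "2 * p"
  interpret Y: independent_entries "two_point_entries ?L" ?L "\<lambda>e y. y e"
    by (rule independent_two_point_entries)
  let ?EX = "measure_pmf.expectation M (\<lambda>\<omega>. mat_trace n (mat_pow n (entry_mat (\<lambda>e. X e \<omega>)) ?L))"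
  let ?EY = "measure_pmf.expectation (two_point_entries ?L) (\<lambda>y. mat_trace ?L (mat_pow ?L (entry_mat y) ?L))"
  have "real ?L * ?EX \<le> real ?L * (\<Sum>w | w \<in> walks n ?L \<and> repeating ?L w. \<delta> ^ (card (w ` {..?L}) - 1))"
    using mean moment \<delta> by (intro mult_left_mono expectation_mat_trace_pow_le) auto
  also have "\<dots> \<le> n * real (card {w. w \<in> walks ?L ?L \<and> repeating ?L w})"
    by (intro repeating_walks_comparison \<delta>)
  also have "\<dots> \<le> n * ?EY"
    by (intro mult_left_mono Y.expectation_mat_trace_pow_ge)
      (simp_all add: expectation_two_point_entry[where f = "\<lambda>y. y"]
        expectation_two_point_entry[where f = "\<lambda>y. y ^ _"] two_point_moment_ge,
       simp add: expectation_two_point)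
  also have "\<dots> \<le> n * (2 * real ?L * (trace_const * real ?L) ^ p)"
    using p by (intro mult_left_mono expectation_two_point_trace_le) auto
  finally have "real ?L * ?EX \<le> real ?L * (2 * n * (2 * trace_const * p) ^ p)"
    by (simp add: mult_ac)
  thus ?thesis using p by simp
qed

section \<open>The centred adjacency matrix\<close>

lemma finite_node_pairs: "finite (node_pairs n)"
  by (rule finite_subset[of _ "Pow {..<n}"]) (auto simp: node_pairs_def)

lemma adjacency_matrix_minus_eq:
  assumes "P = expected_adjacency_matrix n G"
  shows "adjacency_matrix n E - P
    = mat n n (\<lambda>(i, j). entry_mat (\<lambda>e. adjacency_matrix n E $$ e - P $$ e) i j)"
proof (rule eq_matI)
  \<comment> \<open>The edge \<open>{i, j}\<close> is unordered; the same symmetry passes to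
    \<open>P\<close> by taking expectations.\<close>
  have sym: "adjacency_matrix n F $$ edge i j = adjacency_matrix n F $$ (i, j)" if "i < n" "j < n" for F i j
    using that by (auto simp: adjacency_matrix_def edge_def min_def max_def insert_commute)
  fix i j assume "i < dim_row (mat n n (\<lambda>(i, j). entry_mat (\<lambda>e. adjacency_matrix n E $$ e - P $$ e) i j))"
    "j < dim_col (mat n n (\<lambda>(i, j). entry_mat (\<lambda>e. adjacency_matrix n E $$ e - P $$ e) i j))"
  hence ij: "i < n" "j < n" by simp_all
  have P: "P $$ e = measure_pmf.expectation G (\<lambda>F. adjacency_matrix n F $$ e)" if "fst e < n" "snd e < n" for e
    using that by (cases e) (simp add: assms expected_adjacency_matrix_def)
  have "P $$ edge i j = P $$ (i, j)"
    using ij by (simp add: P sym edge_def[of i j, THEN arg_cong[of _ _ fst]] edge_def[of i j, THEN arg_cong[of _ _ snd]])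
  moreover have "adjacency_matrix n E $$ (i, i) = 0" "P $$ (i, i) = 0"
    using ij by (simp_all add: P) (simp_all add: adjacency_matrix_def)
  ultimately show "(adjacency_matrix n E - P) $$ (i, j)
      = mat n n (\<lambda>(i, j). entry_mat (\<lambda>e. adjacency_matrix n E $$ e - P $$ e) i j) $$ (i, j)"
    using ij by (auto simp: assms expected_adjacency_matrix_def entry_mat_def sym)
qed (simp_all add: assms expected_adjacency_matrix_def adjacency_matrix_def)

lemma independent_adjacency_entries:
  assumes "random_graph n G" "independent_edges n G"
  shows "independent_entries G n (\<lambda>e E. adjacency_matrix n E $$ e - P $$ e)"
proof
  show "finite (set_pmf G)"
    using assms(1) finite_node_pairs[of n] by (auto simp: random_graph_def intro: finite_subset)
  have "prob_space.indep_vars G (\<lambda>_. borel) (\<lambda>e E. adjacency_matrix n E $$ e) (edges n)"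
    using assms(2) unfolding independent_edges_def edges_def by (simp add: case_prod_unfold)
  thus "prob_space.indep_vars G (\<lambda>_. borel) (\<lambda>e E. adjacency_matrix n E $$ e - P $$ e) (edges n)"
    by (rule prob_space.indep_vars_compose2[OF measure_pmf.prob_space_axioms, where Y = "\<lambda>e a. a - P $$ e"]) simp
qed

text \<open>Deviations are at most 1 in absolute value, so higher moments are dominated by the
  variance \<open>q - q\<^sup>2\<close>.\<close>

lemma centred_bernoulli_moment_le:
  fixes a :: "'a \<Rightarrow> real"
  assumes "finite (set_pmf M)" "\<And>x. a x \<in> {0, 1}" "2 \<le> k"
  defines "q \<equiv> measure_pmf.expectation M a"
  shows "\<bar>measure_pmf.expectation M (\<lambda>x. (a x - q) ^ k)\<bar> \<le> q" and "0 \<le> q" and "q \<le> 1"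
proof -
  have int: "integrable (measure_pmf M) f" for f :: "'a \<Rightarrow> real"
    by (rule integrable_measure_pmf_finite[OF assms(1)])
  have a: "0 \<le> a x" "a x \<le> 1" "a x * a x = a x" for x using assms(2)[of x] by auto
  show q0: "0 \<le> q" unfolding q_def by (intro Bochner_Integration.integral_nonneg) (simp add: a)
  have "q \<le> measure_pmf.expectation M (\<lambda>_. 1)" unfolding q_def by (intro integral_mono int a)
  thus q1: "q \<le> 1" by simp
  have "\<bar>measure_pmf.expectation M (\<lambda>x. (a x - q) ^ k)\<bar>
      \<le> measure_pmf.expectation M (\<lambda>x. \<bar>(a x - q) ^ k\<bar>)"
    by (rule integral_abs_bound)
  also have "\<dots> \<le> measure_pmf.expectation M (\<lambda>x. (1 - 2 * q) * a x + q\<^sup>2)"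
  proof (intro integral_mono int)
    fix x
    have "\<bar>a x - q\<bar> \<le> 1" using a[of x] q0 q1 by (simp add: abs_le_iff)
    hence "\<bar>a x - q\<bar> ^ k \<le> \<bar>a x - q\<bar> ^ 2" using assms(3) by (intro power_decreasing) auto
    also have "\<dots> = (1 - 2 * q) * a x + q\<^sup>2"
      using a(3)[of x] by (simp add: power2_eq_square algebra_simps)
    finally show "\<bar>(a x - q) ^ k\<bar> \<le> (1 - 2 * q) * a x + q\<^sup>2" by (simp add: power_abs)
  qed
  also have "\<dots> = (1 - 2 * q) * q + q\<^sup>2"
    by (subst Bochner_Integration.integral_add) (simp_all add: int q_def)
  also have "\<dots> \<le> q" by (simp add: power2_eq_square algebra_simps)
  finally show "\<bar>measure_pmf.expectation M (\<lambda>x. (a x - q) ^ k)\<bar> \<le> q" .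
qed

text \<open>Markov's inequality for the trace, which is at least \<open>t ^ (2 * p)\<close> whenever
  the norm exceeds \<open>t\<close>.\<close>

lemma adjacency_spectral_norm_tail:
  fixes n p :: nat and d t :: real
  assumes "1 \<le> n" and G: "random_graph n G" "independent_edges n G"
    and P: "P = expected_adjacency_matrix n G"
    and d: "real n * Max {P $$ (i, j) |i j. i < n \<and> j < n} \<le> d"
    and p: "d \<le> p" "0 < p" and t: "0 < t"
  shows "1 - 2 * n * (2 * trace_const * p / t\<^sup>2) ^ p
    \<le> measure_pmf.prob G {E. spectral_norm (adjacency_matrix n E - P) \<le> t}"
proof -
  define X where "X e E = adjacency_matrix n E $$ e - P $$ e" for e :: "nat \<times> nat" and E
  interpret independent_entries G n X
    unfolding X_def by (rule independent_adjacency_entries[OF G])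
  define S where "S = {P $$ (i, j) |i j. i < n \<and> j < n}"
  define \<delta> where "\<delta> = Max S"
  have S_image: "S = (\<lambda>ij. P $$ ij) ` ({..<n} \<times> {..<n})" by (auto simp: S_def)
  hence fin: "finite S" by simp
  have P_entry: "P $$ (i, j) = measure_pmf.expectation G (\<lambda>E. adjacency_matrix n E $$ (i, j))"
    if "i < n" "j < n" for i j
    using that by (simp add: P expected_adjacency_matrix_def)
  have adj01: "adjacency_matrix n E $$ (i, j) \<in> {0, 1}" if "i < n" "j < n" for E i j
    using that by (simp add: adjacency_matrix_def)
  have moment: "\<bar>measure_pmf.expectation G (\<lambda>E. X (i, j) E ^ k)\<bar> \<le> P $$ (i, j)"
    and P01: "0 \<le> P $$ (i, j)" "P $$ (i, j) \<le> 1" if "i < n" "j < n" "2 \<le> k" for i j k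
    using centred_bernoulli_moment_le[where a = "\<lambda>E. adjacency_matrix n E $$ (i, j)", OF finite_support adj01[OF that(1,2)] that(3)]
    unfolding X_def P_entry[OF that(1,2)] by blast+
  \<comment> \<open>As \<open>n \<ge> 1\<close>, the set \<open>S\<close> is nonempty and its
    \<open>Max\<close> is attained.\<close>
  have P00: "P $$ (0, 0) \<in> S" unfolding S_image using assms(1) by (intro imageI) auto
  have "0 \<le> P $$ (0, 0)" using P01(1)[of 0 0 2] assms(1) by simp
  also have "\<dots> \<le> \<delta>" unfolding \<delta>_def by (rule Max_ge[OF fin P00])
  finally have \<delta>0: "0 \<le> \<delta>" .
  have "\<delta> \<in> S" unfolding \<delta>_def using fin P00 by (intro Max_in) auto
  hence \<delta>1: "\<delta> \<le> 1" using P01(2)[of _ _ 2] by (auto simp: S_def)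
  let ?tr = "\<lambda>E. mat_trace n (mat_pow n (entry_mat (\<lambda>e. X e E)) (2 * p))"
  have trace: "measure_pmf.expectation G ?tr \<le> 2 * n * (2 * trace_const * p) ^ p"
  proof (rule expectation_trace_comparison)
    fix e assume "e \<in> edges n"
    then obtain i j where e: "e = (i, j)" "i < n" "j < n" by (auto simp: edges_def)
    show "measure_pmf.expectation G (X e) = 0"
      unfolding X_def using e by (subst Bochner_Integration.integral_diff) (simp_all add: P_entry)
    fix k :: nat assume "2 \<le> k"
    hence "\<bar>measure_pmf.expectation G (\<lambda>E. X e E ^ k)\<bar> \<le> P $$ e"
      unfolding e(1) using moment e by blast
    also have "\<dots> \<le> \<delta>" unfolding \<delta>_def using e by (intro Max_ge fin) (auto simp: S_def)
    finally show "\<bar>measure_pmf.expectation G (\<lambda>E. X e E ^ k)\<bar> \<le> \<delta>" .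
  qed (use d p \<delta>0 \<delta>1 in \<open>auto simp: \<delta>_def S_def\<close>)
  let ?good = "{E. spectral_norm (adjacency_matrix n E - P) \<le> t}"
  have sub: "- ?good \<subseteq> {E. t ^ (2 * p) \<le> ?tr E}"
  proof (rule subsetI, rule ccontr)
    fix E assume bad: "E \<in> - ?good" "E \<notin> {E. t ^ (2 * p) \<le> ?tr E}"
    hence "spectral_norm (adjacency_matrix n E - P) \<le> t"
      unfolding adjacency_matrix_minus_eq[OF P] X_def
      using t p by (intro spectral_norm_le_trace[of n _ t p] sym_entry_mat) auto
    with bad show False by simp
  qed
  have "measure_pmf.prob G (- ?good) \<le> measure_pmf.prob G {E. t ^ (2 * p) \<le> ?tr E}"
    using sub by (intro measure_pmf.finite_measure_mono) auto
  also have "\<dots> \<le> measure_pmf.expectation G ?tr / t ^ (2 * p)"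
    using integral_Markov_inequality_measure[of "measure_pmf G" ?tr "{}" "t ^ (2 * p)"] t
    by (simp add: mat_trace_even_pow_nonneg sym_entry_mat)
  also have "\<dots> \<le> 2 * n * (2 * trace_const * p) ^ p / t ^ (2 * p)"
    using trace t by (intro divide_right_mono) auto
  also have "\<dots> = 2 * n * (2 * trace_const * p / t\<^sup>2) ^ p"
    by (simp add: power_divide power_mult)
  finally have "measure_pmf.prob G (- ?good) \<le> 2 * n * (2 * trace_const * p / t\<^sup>2) ^ p" .
  moreover have "measure_pmf.prob G (- ?good) = 1 - measure_pmf.prob G ?good"
    using measure_pmf.prob_compl[of ?good G] by (simp add: Compl_eq_Diff_UNIV)
  ultimately show ?thesis by simp
qed

section \<open>Choice of the parameters\<close>

theorem theorem5p2:
  fixes c\<^sub>0 r :: real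
  assumes "c\<^sub>0 > 0" and "r > 0"
  shows "\<exists>C::real. \<forall>(n::nat) (G::nat set set pmf) (P::real mat) (d::real).
    n \<ge> 1 \<longrightarrow>
    random_graph n G \<longrightarrow>
    independent_edges n G \<longrightarrow>
    P = expected_adjacency_matrix n G \<longrightarrow>
    real n * Max {P $$ (i, j) |i j. i < n \<and> j < n} \<le> d \<longrightarrow>
    d \<ge> c\<^sub>0 * ln (real n) \<longrightarrow>
    measure_pmf.prob G {E. spectral_norm (adjacency_matrix n E - P) \<le> C * sqrt d}
      \<ge> 1 - real n powr (- r)"
proof -
  \<comment> \<open>With \<open>p \<ge> a * d\<close> this ensures both \<open>p \<ge> d\<close>,
    for the comparison, and \<open>p \<ge> ln n\<close>, for the probability.\<close>
  define a where "a = max 1 (1 / c\<^sub>0)"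
  \<comment> \<open>Rounding up adds at most 1, which is at most
    \<open>d / (c\<^sub>0 * ln 2)\<close> when \<open>n \<ge> 2\<close>; hence
    \<open>p \<le> b * d\<close>.\<close>
  define b where "b = a + 1 / (c\<^sub>0 * ln 2)"
  \<comment> \<open>Chosen so that the base of the \<open>p\<close>-th power in the tail bound is at
    most \<open>exp (- (r + 2))\<close>.\<close>
  define C where "C = sqrt (2 * trace_const * b * exp (r + 2))"
  have a: "1 \<le> a" "1 \<le> a * c\<^sub>0" using assms(1) by (auto simp: a_def max_def field_simps)
  have b: "0 < b" using a(1) assms(1) by (simp add: b_def add_pos_pos)
  have C: "0 < C" "C\<^sup>2 = 2 * trace_const * b * exp (r + 2)"
    using b trace_const_pos by (simp_all add: C_def)
  show ?thesis
  proof (intro exI[of _ C] allI impI)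
    fix n :: nat and G :: "nat set set pmf" and P :: "real mat" and d :: real
    assume n: "n \<ge> 1" and G: "random_graph n G" "independent_edges n G"
      and P: "P = expected_adjacency_matrix n G"
      and max: "real n * Max {P $$ (i, j) |i j. i < n \<and> j < n} \<le> d"
      and d: "d \<ge> c\<^sub>0 * ln (real n)"
    show "measure_pmf.prob G {E. spectral_norm (adjacency_matrix n E - P) \<le> C * sqrt d}
      \<ge> 1 - real n powr (- r)"
    \<comment> \<open>For \<open>n = 1\<close> the logarithm vanishes and gives no positive lower
      bound on \<open>d\<close>, but the claimed probability is only
      \<open>1 - 1 = 0\<close>.\<close>
    proof (cases "n = 1")
      case False
      with n have n2: "2 \<le> n" by simp
      have "c\<^sub>0 * ln 2 \<le> c\<^sub>0 * ln n" using n2 assms(1) by (intro mult_left_mono) auto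
      hence d_ge: "c\<^sub>0 * ln 2 \<le> d" using d by simp
      have d0: "0 < d" using assms(1) d_ge by (smt (verit) ln_gt_zero mult_pos_pos)
      define p where "p = nat \<lceil>a * d\<rceil>"
      have ad: "0 < a * d" using a(1) d0 by simp
      have p_ge: "a * d \<le> p" unfolding p_def by (rule real_nat_ceiling_ge)
      have p0: "0 < p" using p_ge ad by (smt (verit) of_nat_0_less_iff)
      have "1 * d \<le> a * d" using a(1) d0 by (intro mult_right_mono) auto
      hence dp: "d \<le> p" using p_ge by simp
      have "1 * ln n \<le> (a * c\<^sub>0) * ln n" using a(2) n2 by (intro mult_right_mono) auto
      also have "\<dots> \<le> a * d" using d a(1) by (simp add: mult.assoc mult_left_mono)
      finally have lnp: "ln n \<le> p" using p_ge by simp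
      have "p \<le> a * d + 1" using ad unfolding p_def by linarith
      also have "1 \<le> 1 / (c\<^sub>0 * ln 2) * d" using d_ge assms(1) by (simp add: field_simps)
      finally have pb: "p \<le> b * d" by (simp add: b_def algebra_simps)
      have "2 * trace_const * p / (C * sqrt d)\<^sup>2 = p / (b * d) / exp (r + 2)"
        using d0 b trace_const_pos by (simp add: power_mult_distrib C(2))
      also have "\<dots> \<le> 1 / exp (r + 2)"
        using pb b d0 by (intro divide_right_mono) (auto simp: divide_le_eq)
      also have "\<dots> = exp (- (r + 2))" by (simp only: exp_minus inverse_eq_divide)
      finally have "(2 * trace_const * p / (C * sqrt d)\<^sup>2) ^ p \<le> (exp (- (r + 2))) ^ p"
        using trace_const_pos by (intro power_mono) auto
      also have "\<dots> = exp (- (r + 2) * p)" by (simp add: exp_of_nat_mult mult.commute)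
      also have "\<dots> \<le> exp (- (r + 2) * ln n)" using lnp assms(2) by simp
      also have "\<dots> = real n powr (- r - 2)" using n2 by (simp add: powr_def)
      also have "\<dots> = real n powr (- r) / (real n)\<^sup>2" using n2 by (simp add: powr_diff)
      finally have "2 * n * (2 * trace_const * p / (C * sqrt d)\<^sup>2) ^ p \<le> 2 * n * (real n powr (- r) / (real n)\<^sup>2)"
        by (intro mult_left_mono) auto
      \<comment> \<open>The extra 2 in the exponent of \<open>C\<close> pays for the factor
        \<open>2 * n\<close>, which is at most the square of \<open>n\<close>.\<close>
      also have "\<dots> = 2 / n * real n powr (- r)" using n2 by (simp add: power2_eq_square)
      also have "\<dots> \<le> 1 * real n powr (- r)" using n2 by (intro mult_right_mono) auto
      finally have "2 * n * (2 * trace_const * p / (C * sqrt d)\<^sup>2) ^ p \<le> real n powr (- r)" by simp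
      moreover have "1 - 2 * n * (2 * trace_const * p / (C * sqrt d)\<^sup>2) ^ p
          \<le> measure_pmf.prob G {E. spectral_norm (adjacency_matrix n E - P) \<le> C * sqrt d}"
        using C(1) d0 by (intro adjacency_spectral_norm_tail[OF n G P max dp p0]) simp
      ultimately show ?thesis by linarith
    qed simp
  qed
qed

end
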